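(* Let $n\ge2$, let $u\in h^\infty(\mathbb{R}^n_+)$, and let $x=(x',x_n)\in\mathbb{R}^n_+$. Then the following estimate holds and is sharp: $$|\nabla u(x)|\le\frac{2(n-1)^{(n-1)/2}\,\omega_{n-1}}{n^{n/2}\,\omega_n\,x_n}\ \mathrm{osc}_{\mathbb{R}^n_+}(u),$$ where $\mathrm{osc}_{\mathbb{R}^n_+}(u)$ is the oscillation of $u$ on $\mathbb{R}^n_+$.
   Context: $\mathbb{R}^n_+=\{x=(x',x_n): x'=(x_1,\dots,x_{n-1})\in\mathbb{R}^{n-1},\ x_n>0\}$. $\omega_k=2\pi^{k/2}/\Gamma(k/2)$ denotes the area of the unit sphere in $\mathbb{R}^k$ (so $\omega_1=2$). Functions are real-valued. $h^\infty(\mathbb{R}^n_+)$ is the space of harmonic functions on $\mathbb{R}^n_+$ that can be represented as the Poisson integral $$u(x)=\frac{2}{\omega_n}\int_{\mathbb{R}^{n-1}}\frac{x_n}{|y-x|^n}\,u(y')\,dy',\qquad y=(y',0),\ y'\in\mathbb{R}^{n-1},$$ with boundary values in $L^\infty(\mathbb{R}^{n-1})$. The oscillation is $\mathrm{osc}_{\mathbb{R}^n_+}(u)=\sup_{\mathbb{R}^n_+}u-\inf_{\mathbb{R}^n_+}u$. "Sharp" means that, for each $x$, the coefficient of $\mathrm{osc}_{\mathbb{R}^n_+}(u)$ is the smallest constant for which the inequality holds for all $u\in h^\infty(\mathbb{R}^n_+)$. *)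

theory Defs
  imports "HOL-Analysis.Analysis"
begin

(* Throughout, R^(n-1) is real ^ 'm with n = CARD('m) + 1, and R^n is the product space
   (real ^ 'm) \<times> real, whose product norm is the Euclidean one; a point x = (x', x_n) is a pair. *)

definition half_space :: "((real ^ 'm) \<times> real) set" where
  "half_space = {x. snd x > 0}"

definition omega :: "nat \<Rightarrow> real" where
  "omega k = 2 * pi powr (real k / 2) / Gamma (real k / 2)"

definition grad :: "('a::euclidean_space \<Rightarrow> real) \<Rightarrow> 'a \<Rightarrow> 'a" where
  "grad u x = (THE D. GDERIV u x :> D)"

definition partial :: "'a::euclidean_space \<Rightarrow> ('a \<Rightarrow> real) \<Rightarrow> 'a \<Rightarrow> real" where
  "partial b u x = frechet_derivative u (at x) b"

(* The first three conditions say that u is of class C^2 on S (meant for open S). *)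
definition harmonic_on :: "'a::euclidean_space set \<Rightarrow> ('a \<Rightarrow> real) \<Rightarrow> bool" where
  "harmonic_on S u \<longleftrightarrow>
     (\<forall>x\<in>S. u differentiable (at x)) \<and>
     (\<forall>b\<in>Basis. \<forall>x\<in>S. partial b u differentiable (at x)) \<and>
     (\<forall>b\<in>Basis. \<forall>c\<in>Basis. continuous_on S (partial c (partial b u))) \<and>
     (\<forall>x\<in>S. (\<Sum>b\<in>Basis. partial b (partial b u) x) = 0)"

definition L_infinity :: "('a::euclidean_space \<Rightarrow> real) set" where
  "L_infinity = {f. f \<in> borel_measurable lebesgue \<and> (\<exists>M. AE y in lebesgue. \<bar>f y\<bar> \<le> M)}"

definition poisson_integral :: "(real ^ 'm \<Rightarrow> real) \<Rightarrow> (real ^ 'm) \<times> real \<Rightarrow> real" where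
  "poisson_integral f x =
     2 / omega (CARD('m) + 1) *
     (LINT y|lebesgue. snd x / norm ((y, 0) - x) ^ (CARD('m) + 1) * f y)"

definition h_infinity :: "((real ^ 'm) \<times> real \<Rightarrow> real) set" where
  "h_infinity = {u. harmonic_on half_space u \<and>
     (\<exists>f\<in>L_infinity. \<forall>x\<in>half_space. u x = poisson_integral f x)}"

(* Members of h_infinity are bounded on the half-space, so the real SUP and INF are the true ones. *)
definition osc :: "((real ^ 'm) \<times> real \<Rightarrow> real) \<Rightarrow> real" where
  "osc u = (SUP x\<in>half_space. u x) - (INF x\<in>half_space. u x)"

end

theory Submission
  imports Defs
begin

text \<open>
  The gradient of the Poisson integral of \<open>f\<close> at \<open>x\<close> in direction \<open>l\<close> is the integral of \<open>f\<close> against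
  a kernel of mean zero, so it is at most \<open>osc u\<close> times half the \<open>L\<^sup>1\<close> norm of that kernel, with
  equality for \<open>l\<close> vertical and \<open>f\<close> the indicator of the set where the kernel is positive.
  By central projection, that \<open>L\<^sup>1\<close> norm is a multiple of the integral over the unit ball of the
  absolute value of the quadratic form \<open>(e \<bullet> l) |w|\<^sup>2 - n (w \<bullet> e) (w \<bullet> l)\<close>, where \<open>e\<close> is the vertical unit
  vector. With \<open>a = (1 + e \<bullet> l) / 2\<close> and \<open>p\<close>, \<open>q\<close> the unit vectors along \<open>e + l\<close> and \<open>e - l\<close>, this form
  equals \<open>a (|w|\<^sup>2 - n (w \<bullet> p)\<^sup>2) - (1 - a) (|w|\<^sup>2 - n (w \<bullet> q)\<^sup>2)\<close>, and both terms have the same integral of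
  absolute values by rotation invariance. Hence the vertical direction is extremal, and the integral for it is
  computed in polar coordinates, where the kernel is a total derivative.
\<close>

subsection \<open>Lebesgue measure and central projection\<close>

text \<open>Centring the boundary function \<open>f\<close> at the midpoint of its range gives a
  bound by the oscillation of \<open>f\<close>, whereas the theorem speaks of the oscillation of
  \<open>u\<close> on the open half-space. The semigroup property of Poisson integrals bridges this:
  a slice of \<open>u\<close> at a small height d serves as boundary function in place of
  \<open>f\<close>, and d tends to 0. The quadratic form is the numerator of the directional
  derivative of the kernel. The kernel on the hyperplane has no rotational symmetry that mixes
  vertical and horizontal directions; the ball has, and this is why the directions are compared
  there. With m = n - 1, the vertical kernel at height 1 changes sign on the sphere of radius sqrt
  m. The flux through that sphere is \<open>omega m\<close> times m^(m/2) / n^(n/2); together with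
  the normalisation \<open>2 / omega n\<close> it is the constant of the theorem, and the factor 1 /
  x_n comes from scaling.\<close>

lemma nn_integral_lborel_translation:
  fixes g :: "'a::euclidean_space \<Rightarrow> ennreal"
  assumes [measurable]: "g \<in> borel_measurable borel"
  shows "(\<integral>\<^sup>+x. g (a + x) \<partial>lborel) = (\<integral>\<^sup>+x. g x \<partial>lborel)"
  by (subst (2) lborel_distr_plus[symmetric, of a]) (simp add: nn_integral_distr)

lemma nn_integral_lborel_scale:
  fixes g :: "'a::euclidean_space \<Rightarrow> ennreal"
  assumes [measurable]: "g \<in> borel_measurable borel" and c: "c \<noteq> 0"
  shows "(\<integral>\<^sup>+x. g x \<partial>lborel) = ennreal (\<bar>c\<bar> ^ DIM('a)) * (\<integral>\<^sup>+x. g (c *\<^sub>R x) \<partial>lborel)"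
  using c by (subst lborel_affine[OF c, of 0])
     (simp add: nn_integral_density nn_integral_distr nn_integral_cmult ennreal_power)

lemma integral_lborel_translation:
  fixes g :: "'a::euclidean_space \<Rightarrow> 'b::{banach,second_countable_topology}"
  assumes [measurable]: "g \<in> borel_measurable borel"
  shows "(\<integral>x. g (a + x) \<partial>lborel) = (\<integral>x. g x \<partial>lborel)"
  by (subst (2) lborel_distr_plus[symmetric, of a]) (simp add: integral_distr)

lemma integral_lborel_scale:
  fixes g :: "'a::euclidean_space \<Rightarrow> real"
  assumes [measurable]: "g \<in> borel_measurable borel" and c: "c \<noteq> 0"
  shows "(\<integral>x. g x \<partial>lborel) = \<bar>c\<bar> ^ DIM('a) * (\<integral>x. g (c *\<^sub>R x) \<partial>lborel)"
  using c by (subst lborel_affine[OF c, of 0])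
     (simp add: integral_density integral_distr ennreal_power)

text \<open>As in the uniqueness of Haar measure: integrate \<open>g (T x) * indicator B (y - T x)\<close> over \<open>x\<close> and \<open>y\<close>
  in both orders, where \<open>B\<close> is the unit ball, which \<open>T\<close> preserves.\<close>

lemma nn_integral_lborel_involution:
  fixes g :: "'a::euclidean_space \<Rightarrow> ennreal"
  assumes g[measurable]: "g \<in> borel_measurable borel"
    and T: "linear T" "\<And>v. norm (T v) = norm v" "\<And>v. T (T v) = v"
  shows "(\<integral>\<^sup>+x. g (T x) \<partial>lborel) = (\<integral>\<^sup>+x. g x \<partial>lborel)"
proof -
  have [measurable]: "T \<in> borel \<rightarrow>\<^sub>M borel"
    using T(1) by (intro borel_measurable_continuous_onI linear_continuous_on linear_linear[THEN iffD1])
      (simp add: linear_conv_bounded_linear)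
  define B :: "'a set" where "B = ball 0 1"
  have [measurable]: "B \<in> sets borel" by (simp add: B_def)
  have Binv: "indicator B (- T x) = (indicator B x :: ennreal)" for x
    using T(2) by (auto simp: B_def indicator_def)
  define V where "V = emeasure lborel B"
  have V: "V \<noteq> 0" "V \<noteq> \<infinity>"
    by (auto simp: V_def B_def emeasure_ball unit_ball_vol_def Gamma_real_pos_exp)
  have "V * (\<integral>\<^sup>+x. g (T x) \<partial>lborel) = (\<integral>\<^sup>+x. g (T x) * V \<partial>lborel)"
    by (subst mult.commute, rule nn_integral_multc[symmetric]) measurable
  also have "\<dots> = (\<integral>\<^sup>+x. (\<integral>\<^sup>+y. g (T x) * indicator B (- T x + y) \<partial>lborel) \<partial>lborel)"
  proof (rule nn_integral_cong)
    fix x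
    have "(\<integral>\<^sup>+y. indicator B (- T x + y) \<partial>lborel) = V"
      unfolding V_def by (subst nn_integral_lborel_translation) simp_all
    thus "g (T x) * V = (\<integral>\<^sup>+y. g (T x) * indicator B (- T x + y) \<partial>lborel)"
      by (subst nn_integral_cmult) simp_all
  qed
  also have "\<dots> = (\<integral>\<^sup>+y. (\<integral>\<^sup>+x. g (T x) * indicator B (- T x + y) \<partial>lborel) \<partial>lborel)"
    by (rule lborel_pair.Fubini'[symmetric]) measurable
  \<comment> \<open>Since \<open>T (T y) = y\<close>, the shift by \<open>T y\<close> turns the
    argument of \<open>g\<close> into \<open>y + T x\<close> and that of the indicator into
    \<open>- T x\<close>. The indicator then no longer involves \<open>y\<close>, and translation
    invariance in \<open>y\<close> removes \<open>T\<close> from \<open>g\<close>.\<close>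
  also have "\<dots> = (\<integral>\<^sup>+y. (\<integral>\<^sup>+x. g (T (T y + x)) * indicator B (- T (T y + x) + y) \<partial>lborel) \<partial>lborel)"
    by (intro nn_integral_cong nn_integral_lborel_translation[symmetric]) measurable
  also have "\<dots> = (\<integral>\<^sup>+y. (\<integral>\<^sup>+x. g (T x + y) * indicator B x \<partial>lborel) \<partial>lborel)"
    using T by (simp add: linear_add Binv add.commute)
  also have "\<dots> = (\<integral>\<^sup>+x. (\<integral>\<^sup>+y. g (T x + y) * indicator B x \<partial>lborel) \<partial>lborel)"
    by (rule lborel_pair.Fubini'[symmetric]) measurable
  also have "\<dots> = V * (\<integral>\<^sup>+x. g x \<partial>lborel)"
  proof -
    have "(\<integral>\<^sup>+y. g (T x + y) * indicator B x \<partial>lborel) = (\<integral>\<^sup>+y. g y \<partial>lborel) * indicator B x" for x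
      by (subst nn_integral_multc) (simp_all add: nn_integral_lborel_translation)
    hence "(\<integral>\<^sup>+x. (\<integral>\<^sup>+y. g (T x + y) * indicator B x \<partial>lborel) \<partial>lborel) =
        (\<integral>\<^sup>+y. g y \<partial>lborel) * V"
      by (simp only: V_def, subst nn_integral_cmult_indicator) simp_all
    thus ?thesis by (simp only: mult.commute)
  qed
  finally have "V * (\<integral>\<^sup>+x. g (T x) \<partial>lborel) = V * (\<integral>\<^sup>+x. g x \<partial>lborel)" .
  thus ?thesis
    using V by (simp add: ennreal_mult_cancel_left)
qed

text \<open>The reflection in the hyperplane orthogonal to \<open>p - q\<close>. It is an
  involution, the kind of isometry for which invariance of Lebesgue measure has been
  established.\<close>

lemma reflection_swapping:
  fixes p q :: "'a::euclidean_space"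
  assumes "norm p = norm q"
  obtains T where "linear T" "\<And>v. norm (T v) = norm v" "\<And>v. T (T v) = v" "T p = q"
proof (cases "p = q")
  case True
  then show ?thesis using that[of id] linear_id by auto
next
  case False
  define d where "d = p - q"
  have d: "d \<bullet> d \<noteq> 0" using False by (simp add: d_def)
  define T where "T v = v - (2 * (v \<bullet> d) / (d \<bullet> d)) *\<^sub>R d" for v
  have "linear T"
    unfolding T_def by (intro linearI) (auto simp: algebra_simps inner_simps add_divide_distrib)
  moreover have Td: "T v \<bullet> d = - (v \<bullet> d)" for v
    using d by (simp add: T_def inner_simps)
  moreover have "T (T v) = v" for v
    by (subst T_def, subst Td) (simp add: T_def)
  moreover have "T v \<bullet> T v = v \<bullet> v" for v
  proof -
    have "T v \<bullet> T v = T v \<bullet> v - (2 * (v \<bullet> d) / (d \<bullet> d)) * (T v \<bullet> d)"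
      by (subst (2) T_def) (simp add: inner_simps)
    also have "\<dots> = v \<bullet> v"
      by (subst Td) (simp add: T_def inner_simps inner_commute)
    finally show ?thesis .
  qed
  moreover have "T p = q"
  proof -
    have "p \<bullet> p = q \<bullet> q" using assms by (simp add: norm_eq)
    \<comment> \<open>Equal norms make the coefficient in \<open>T p\<close> equal to 1, so exactly
      one copy of \<open>d\<close> is subtracted.\<close>
    hence "d \<bullet> d = 2 * (p \<bullet> d)"
      by (simp add: d_def inner_simps inner_commute)
    hence "T p = p - d" using d by (simp add: T_def)
    thus ?thesis by (simp add: d_def)
  qed
  ultimately show ?thesis using that[of T] by (simp add: norm_eq)
qed

lemma nn_integral_abs_power_interval:
  fixes a :: real
  assumes a: "a > 0"
  shows "(\<integral>\<^sup>+s. ennreal (\<bar>s\<bar> ^ k) * indicator {- a<..<a} s \<partial>lborel) = ennreal (2 * a ^ Suc k / Suc k)"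
proof -
  have half: "(\<integral>\<^sup>+s. ennreal (s ^ k) * indicator {0..a} s \<partial>lborel) = ennreal (a ^ Suc k / Suc k)"
  proof -
    have "(\<integral>\<^sup>+s. ennreal (s ^ k) * indicator {0..a} s \<partial>lborel) = a ^ Suc k / Suc k - 0 ^ Suc k / Suc k"
    proof (intro nn_integral_FTC_Icc)
      show "((\<lambda>s. s ^ Suc k / Suc k) has_real_derivative s ^ k) (at s)" for s :: real
        using DERIV_cdivide[OF DERIV_pow[of "Suc k" s], of "Suc k"] by simp
    qed (use a in auto)
    thus ?thesis by simp
  qed
  have half': "(\<integral>\<^sup>+s. ennreal ((- s) ^ k) * indicator {0..a} (- s) \<partial>lborel) = ennreal (a ^ Suc k / Suc k)"
    using half nn_integral_real_affine[of "\<lambda>s. ennreal (s ^ k) * indicator {0..a} s" "-1" 0] by simp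
  have "(\<integral>\<^sup>+s. ennreal (\<bar>s\<bar> ^ k) * indicator {- a<..<a} s \<partial>lborel) =
        (\<integral>\<^sup>+s. ennreal (s ^ k) * indicator {0..a} s + ennreal ((- s) ^ k) * indicator {0..a} (- s) \<partial>lborel)"
  proof (rule nn_integral_cong_AE)
    \<comment> \<open>Both closed halves contain 0, which would count twice for
      \<open>k = 0\<close>, and they contain the endpoints, which the open interval omits.\<close>
    have "AE s in lborel. s \<noteq> 0 \<and> s \<noteq> a \<and> s \<noteq> - a"
      by (intro AE_conjI AE_lborel_singleton)
    then show "AE s in lborel. ennreal (\<bar>s\<bar> ^ k) * indicator {- a<..<a} s =
        ennreal (s ^ k) * indicator {0..a} s + ennreal ((- s) ^ k) * indicator {0..a} (- s)"
      by eventually_elim (auto simp: indicator_def abs_if)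
  qed
  also have "\<dots> = ennreal (a ^ Suc k / Suc k) + ennreal (a ^ Suc k / Suc k)"
    by (subst nn_integral_add) (auto simp: half half')
  also have "\<dots> = ennreal (2 * a ^ Suc k / Suc k)"
    using a by (subst ennreal_plus[symmetric]) auto
  finally show ?thesis .
qed

text \<open>Central projection of the unit ball to the hyperplane at height 1.\<close>

lemma nn_integral_ball_homogeneous:
  fixes q :: "(real ^ 'm) \<times> real \<Rightarrow> real"
  assumes [measurable]: "q \<in> borel_measurable borel"
    and hom: "\<And>s w. s \<noteq> 0 \<Longrightarrow> q (s *\<^sub>R w) = \<bar>s\<bar> ^ k * q w"
    and nonneg: "\<And>w. 0 \<le> q w"
  shows "(\<integral>\<^sup>+w. ennreal (q w) * indicator (ball 0 1) w \<partial>lborel) =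
    ennreal (2 / real (CARD('m) + 1 + k)) *
      (\<integral>\<^sup>+y. ennreal (q (y, 1) / norm (y, 1::real) ^ (CARD('m) + 1 + k)) \<partial>lborel)"
proof -
  have [measurable]: "(ball 0 1 :: ((real ^ 'm) \<times> real) set) \<in> sets borel" by simp
  let ?N = "CARD('m) + 1 + k"
  let ?g = "\<lambda>w. ennreal (q w) * indicator (ball 0 1) w"
  have [measurable]: "?g \<in> borel_measurable (borel \<Otimes>\<^sub>M borel)"
    by (simp add: borel_prod)
  have pos: "norm (y, 1::real) > 0" for y :: "real ^ 'm"
    by (simp add: norm_prod_def add_nonneg_pos)
  have "(\<integral>\<^sup>+w. ?g w \<partial>lborel) = (\<integral>\<^sup>+w. ?g w \<partial>(lborel \<Otimes>\<^sub>M lborel))"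
    by (simp add: lborel_prod)
  also have "\<dots> = (\<integral>\<^sup>+s. (\<integral>\<^sup>+z. ?g (z, s) \<partial>lborel) \<partial>lborel)"
    by (rule lborel_pair.nn_integral_snd[symmetric]) simp
  also have "\<dots> = (\<integral>\<^sup>+s. (\<integral>\<^sup>+y. ennreal (q (y, 1)) *
      (ennreal (\<bar>s\<bar> ^ (CARD('m) + k)) * indicator {- (1 / norm (y, 1::real))<..<1 / norm (y, 1::real)} s) \<partial>lborel) \<partial>lborel)"
  proof (rule nn_integral_cong_AE)
    show "AE s in lborel. (\<integral>\<^sup>+z. ?g (z, s) \<partial>lborel) = (\<integral>\<^sup>+y. ennreal (q (y, 1)) *
      (ennreal (\<bar>s\<bar> ^ (CARD('m) + k)) * indicator {- (1 / norm (y, 1::real))<..<1 / norm (y, 1::real)} s) \<partial>lborel)"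
      using AE_lborel_singleton[of 0]
    proof eventually_elim
      case (elim s)
      \<comment> \<open>The slice at height \<open>s\<close> is parametrised by
        \<open>z = s *\<^sub>R y\<close>. The substitution contributes
        \<open>\<bar>s\<bar> ^ CARD('m)\<close>, homogeneity \<open>\<bar>s\<bar> ^ k\<close>, and
        membership in the ball becomes \<open>\<bar>s\<bar> < 1 / norm (y, 1)\<close>.\<close>
      have "(\<integral>\<^sup>+z. ?g (z, s) \<partial>lborel) = ennreal (\<bar>s\<bar> ^ CARD('m)) * (\<integral>\<^sup>+y. ?g (s *\<^sub>R y, s) \<partial>lborel)"
        using elim by (subst nn_integral_lborel_scale[of _ s]) auto
      also have "\<dots> = (\<integral>\<^sup>+y. ennreal (\<bar>s\<bar> ^ CARD('m)) * ?g (s *\<^sub>R y, s) \<partial>lborel)"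
        by (rule nn_integral_cmult[symmetric]) measurable
      also have "\<dots> = (\<integral>\<^sup>+y. ennreal (q (y, 1)) *
          (ennreal (\<bar>s\<bar> ^ (CARD('m) + k)) * indicator {- (1 / norm (y, 1::real))<..<1 / norm (y, 1::real)} s) \<partial>lborel)"
      proof (rule nn_integral_cong)
        fix y :: "real ^ 'm"
        have sy: "(s *\<^sub>R y, s) = s *\<^sub>R (y, 1)" by simp
        have q: "q (s *\<^sub>R y, s) = \<bar>s\<bar> ^ k * q (y, 1)"
          unfolding sy using elim by (rule hom)
        have "norm (s *\<^sub>R y, s) = \<bar>s\<bar> * norm (y, 1::real)"
          unfolding sy by (rule norm_scaleR)
        hence "indicator (ball 0 1) (s *\<^sub>R y, s) =
            (indicator {- (1 / norm (y, 1::real))<..<1 / norm (y, 1::real)} s :: ennreal)"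
          using pos[of y] abs_less_iff[of s "1 / norm (y, 1::real)"] pos_less_divide_eq[OF pos[of y], of "\<bar>s\<bar>" 1]
          by (auto simp: indicator_def)
        thus "ennreal (\<bar>s\<bar> ^ CARD('m)) * ?g (s *\<^sub>R y, s) = ennreal (q (y, 1)) *
          (ennreal (\<bar>s\<bar> ^ (CARD('m) + k)) * indicator {- (1 / norm (y, 1::real))<..<1 / norm (y, 1::real)} s)"
          using nonneg[of "(y,1)"]
          by (simp add: q power_add ennreal_mult mult_ac)
      qed
      finally show ?case .
    qed
  qed
  also have "\<dots> = (\<integral>\<^sup>+y. (\<integral>\<^sup>+s. ennreal (q (y, 1)) *
      (ennreal (\<bar>s\<bar> ^ (CARD('m) + k)) * indicator {- (1 / norm (y, 1::real))<..<1 / norm (y, 1::real)} s) \<partial>lborel) \<partial>lborel)"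
    by (rule lborel_pair.Fubini') (simp add: indicator_def)
  \<comment> \<open>For fixed \<open>y\<close> only a power of \<open>\<bar>s\<bar>\<close> is left
    on a symmetric interval; its integral supplies both the factor \<open>2 / ?N\<close> and the
    power of \<open>norm (y, 1)\<close>.\<close>
  also have "\<dots> = (\<integral>\<^sup>+y. ennreal (2 / real ?N) * ennreal (q (y, 1) / norm (y, 1::real) ^ ?N) \<partial>lborel)"
  proof (rule nn_integral_cong)
    fix y :: "real ^ 'm"
    show "(\<integral>\<^sup>+s. ennreal (q (y, 1)) *
      (ennreal (\<bar>s\<bar> ^ (CARD('m) + k)) * indicator {- (1 / norm (y, 1::real))<..<1 / norm (y, 1::real)} s) \<partial>lborel)
      = ennreal (2 / real ?N) * ennreal (q (y, 1) / norm (y, 1::real) ^ ?N)"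
      using pos[of y] nonneg[of "(y,1)"]
      by (subst nn_integral_cmult)
         (auto simp: nn_integral_abs_power_interval ennreal_mult[symmetric] power_divide mult_ac)
  qed
  also have "\<dots> = ennreal (2 / real ?N) * (\<integral>\<^sup>+y. ennreal (q (y, 1) / norm (y, 1::real) ^ ?N) \<partial>lborel)"
    by (rule nn_integral_cmult) measurable
  finally show ?thesis .
qed

subsection \<open>Integral operators with kernels on the half-space\<close>

text \<open>The mean value inequality on the ball bounds the increment of \<open>F _ y\<close> by
  \<open>g y\<close> times the distance, and the linear part obeys the same bound. So the remainder
  quotients are dominated by \<open>2 * g y\<close>, and dominated convergence along sequences gives
  the derivative.\<close>

lemma has_derivative_integral_dominated:
  fixes F :: "'a::euclidean_space \<Rightarrow> 'b \<Rightarrow> real" and F' :: "'a \<Rightarrow> 'b \<Rightarrow> 'a"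
  assumes r: "r > 0"
    and int: "\<And>z. z \<in> ball x r \<Longrightarrow> integrable M (F z)"
    and F'[measurable]: "F' x \<in> borel_measurable M"
    and der: "\<And>z y. z \<in> ball x r \<Longrightarrow> ((\<lambda>z. F z y) has_derivative (\<lambda>h. h \<bullet> F' z y)) (at z)"
    and bound: "\<And>z y. z \<in> ball x r \<Longrightarrow> norm (F' z y) \<le> g y"
    and g: "integrable M g"
  shows "((\<lambda>z. \<integral>y. F z y \<partial>M) has_derivative (\<lambda>h. h \<bullet> (\<integral>y. F' x y \<partial>M))) (at x)"
proof -
  have x: "x \<in> ball x r" using r by simp
  have intF': "integrable M (F' x)"
    by (rule Bochner_Integration.integrable_bound[OF g]) (auto intro!: AE_I2 order_trans[OF bound[OF x] abs_ge_self])
  have lip: "\<bar>F z y - F x y\<bar> \<le> g y * norm (z - x)" if z: "z \<in> ball x r" for z y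
  proof -
    have "norm (F z y - F x y) \<le> g y * norm (z - x)"
    proof (rule differentiable_bound[where S = "ball x r" and f' = "\<lambda>w h. h \<bullet> F' w y"])
      fix w assume w: "w \<in> ball x r"
      show "((\<lambda>z. F z y) has_derivative (\<lambda>h. h \<bullet> F' w y)) (at w within ball x r)"
        using der[OF w] by (rule has_derivative_at_withinI)
      show "onorm (\<lambda>h. h \<bullet> F' w y) \<le> g y"
        using bound[OF w, of y] norm_ge_zero[of "F' w y"]
        by (intro onorm_le) (metis Cauchy_Schwarz_ineq2 mult.commute mult_right_mono norm_ge_zero order_trans real_norm_def)
    qed (use z x in auto)
    thus ?thesis by simp
  qed
  let ?R = "\<lambda>z y. (1 / norm (z - x)) *\<^sub>R (F z y - (F x y + (z - x) \<bullet> F' x y))"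
  have "((\<lambda>z. (1 / norm (z - x)) *\<^sub>R ((\<integral>y. F z y \<partial>M) - ((\<integral>y. F x y \<partial>M) + (z - x) \<bullet> (\<integral>y. F' x y \<partial>M))))
      \<longlongrightarrow> 0) (at x)"
    unfolding tendsto_at_iff_sequentially
  proof (intro allI impI)
    fix X assume X: "\<forall>i. X i \<in> UNIV - {x}" "X \<longlonglongrightarrow> x"
    then obtain N where N: "\<And>n. n \<ge> N \<Longrightarrow> dist (X n) x < r"
      using r unfolding lim_sequentially by blast
    define Y where "Y n = X (n + N)" for n
    have Y: "Y n \<in> ball x r" "Y n \<noteq> x" for n
      using N[of "n + N"] X(1) by (auto simp: Y_def dist_commute)
    have Ylim: "Y \<longlonglongrightarrow> x"
      unfolding Y_def using X(2) by (rule LIMSEQ_ignore_initial_segment)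
    have "(\<lambda>n. \<integral>y. ?R (Y n) y \<partial>M) \<longlonglongrightarrow> (\<integral>y. 0 \<partial>M)"
    proof (rule integral_dominated_convergence)
      show "integrable M (\<lambda>y. 2 * g y)" using g by simp
      show "(\<lambda>y. ?R (Y n) y) \<in> borel_measurable M" for n
        using int[OF Y(1)] int[OF x] by (auto intro!: borel_measurable_scaleR borel_measurable_diff borel_measurable_add)
      show "AE y in M. (\<lambda>n. ?R (Y n) y) \<longlonglongrightarrow> 0"
      proof (rule AE_I2)
        fix y
        have "((\<lambda>z. ?R z y) \<longlongrightarrow> 0) (at x)"
          using der[OF x, of y] by (simp add: has_derivative_within)
        thus "(\<lambda>n. ?R (Y n) y) \<longlonglongrightarrow> 0"
          using Y(2) Ylim unfolding tendsto_at_iff_sequentially comp_def by blast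
      qed
      show "AE y in M. norm (?R (Y n) y) \<le> 2 * g y" for n
      proof (rule AE_I2)
        fix y
        have "\<bar>(Y n - x) \<bullet> F' x y\<bar> \<le> norm (Y n - x) * norm (F' x y)"
          by (rule Cauchy_Schwarz_ineq2)
        also have "\<dots> \<le> norm (Y n - x) * g y"
          using bound[OF x] by (intro mult_left_mono) auto
        finally have "\<bar>F (Y n) y - (F x y + (Y n - x) \<bullet> F' x y)\<bar> \<le> 2 * g y * norm (Y n - x)"
          using lip[OF Y(1)[of n], of y] by (simp add: algebra_simps)
        thus "norm (?R (Y n) y) \<le> 2 * g y"
          using Y(2)[of n] by (simp add: field_simps)
      qed
    qed simp
    moreover have "(\<integral>y. ?R (Y n) y \<partial>M) = (1 / norm (Y n - x)) *\<^sub>R ((\<integral>y. F (Y n) y \<partial>M) -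
        ((\<integral>y. F x y \<partial>M) + (Y n - x) \<bullet> (\<integral>y. F' x y \<partial>M)))" for n
      using int[OF Y(1)[of n]] int[OF x] intF' Y(2)[of n] by simp
    ultimately have "(\<lambda>n. (1 / norm (Y n - x)) *\<^sub>R ((\<integral>y. F (Y n) y \<partial>M) -
        ((\<integral>y. F x y \<partial>M) + (Y n - x) \<bullet> (\<integral>y. F' x y \<partial>M)))) \<longlonglongrightarrow> 0"
      by (simp only: Bochner_Integration.integral_zero)
    thus "((\<lambda>z. (1 / norm (z - x)) *\<^sub>R ((\<integral>y. F z y \<partial>M) - ((\<integral>y. F x y \<partial>M) + (z - x) \<bullet> (\<integral>y. F' x y \<partial>M)))) \<circ> X)
      \<longlonglongrightarrow> 0"
      unfolding Y_def comp_def by (rule LIMSEQ_offset)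
  qed
  thus ?thesis
    by (simp add: has_derivative_within bounded_linear_inner_left)
qed

section \<open>Reduction to height 1 and the total mass of the boundary kernel\<close>

text \<open>The substitution of \<open>fst x - snd x *\<^sub>R y\<close> for \<open>y\<close> turns
  \<open>x - (y, 0)\<close> into \<open>snd x *\<^sub>R (y, 1)\<close>. For homogeneous kernels
  everything is thereby reduced to the hyperplane at height 1, the target of the central
  projection.\<close>

lemma nn_integral_boundary_affine:
  fixes g :: "(real ^ 'm) \<times> real \<Rightarrow> ennreal"
  assumes [measurable]: "g \<in> borel_measurable borel" and x: "x \<in> half_space"
  shows "(\<integral>\<^sup>+y. g (x - (y, 0)) \<partial>lborel) =
    ennreal (snd x ^ CARD('m)) * (\<integral>\<^sup>+y. g (snd x *\<^sub>R (y, 1)) \<partial>lborel)"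
proof -
  have t: "snd x > 0" using x by (simp add: half_space_def)
  have "(\<integral>\<^sup>+y. g (x - (y, 0)) \<partial>lborel) = (\<integral>\<^sup>+y. g (x - (fst x + y, 0)) \<partial>lborel)"
    by (rule nn_integral_lborel_translation[symmetric]) measurable
  also have "\<dots> = ennreal (\<bar>- snd x\<bar> ^ CARD('m)) * (\<integral>\<^sup>+y. g (x - (fst x + (- snd x) *\<^sub>R y, 0)) \<partial>lborel)"
    using t by (subst nn_integral_lborel_scale[of _ "- snd x"]) simp_all
  also have "(\<lambda>y. x - (fst x + (- snd x) *\<^sub>R y, 0)) = (\<lambda>y. snd x *\<^sub>R (y, 1))"
    by (auto simp: prod_eq_iff)
  finally show ?thesis using t by simp
qed

lemma half_space_diff_boundary [simp]: "x - (y, 0) \<in> half_space \<longleftrightarrow> x \<in> half_space"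
  by (simp add: half_space_def)

lemma half_space_nonzero: "w \<in> half_space \<Longrightarrow> norm w > 0"
  by (auto simp: half_space_def)

lemma snd_le_norm: "\<bar>snd w\<bar> \<le> norm w"
  using norm_snd_le[of "snd w" "fst w"] by simp

lemma open_half_space: "open (half_space :: ((real ^ 'm) \<times> real) set)"
  unfolding half_space_def by (intro open_Collect_less continuous_intros)

lemma omega_eq_unit_ball_vol:
  assumes "k > 0"
  shows "omega k = real k * unit_ball_vol (real k)"
proof -
  define r where "r = real k / 2"
  have r: "r > 0" "real k = 2 * r" using assms by (simp_all add: r_def)
  hence "Gamma (r + 1) = r * Gamma r" by (intro Gamma_plus1) auto
  thus ?thesis
    using r by (simp add: unit_ball_vol_def omega_def)
qed

text \<open>Central projection of the constant function 1, of degree 0: the left side times 2 / n is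
  the volume of the unit ball, and n times that volume is the area of the sphere. This is where the
  normalisation of the Poisson integral comes from.\<close>

lemma nn_integral_boundary_kernel:
  "(\<integral>\<^sup>+y. ennreal (1 / norm (y :: real ^ 'm, 1::real) ^ (CARD('m) + 1)) \<partial>lborel) =
    ennreal (omega (CARD('m) + 1) / 2)"
proof -
  let ?N = "CARD('m) + 1"
  let ?I = "\<integral>\<^sup>+y. ennreal (1 / norm (y :: real ^ 'm, 1::real) ^ ?N) \<partial>lborel"
  have "ennreal (unit_ball_vol ?N) = (\<integral>\<^sup>+w. ennreal 1 * indicator (ball (0 :: (real ^ 'm) \<times> real) 1) w \<partial>lborel)"
    by (simp add: emeasure_ball)
  also have "\<dots> = ennreal (2 / ?N) * ?I"
    by (subst nn_integral_ball_homogeneous[where k = 0]) auto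
  finally have "ennreal (?N / 2) * ennreal (unit_ball_vol ?N) = (ennreal (?N / 2) * ennreal (2 / ?N)) * ?I"
    by (simp only: mult.assoc)
  also have "ennreal (?N / 2) * ennreal (2 / ?N) = 1"
    by (subst ennreal_mult[symmetric]) auto
  finally have "?I = ennreal (?N / 2 * unit_ball_vol ?N)"
    by (subst ennreal_mult) (simp_all only: mult_1_left unit_ball_vol_nonneg of_nat_0_le_iff divide_nonneg_nonneg zero_le_numeral)
  also have "?N / 2 * unit_ball_vol ?N = omega ?N / 2"
    by (simp add: omega_eq_unit_ball_vol)
  finally show ?thesis .
qed

lemma integrable_boundary_kernel:
  fixes x :: "(real ^ 'm) \<times> real"
  assumes x: "x \<in> half_space"
  shows "integrable lborel (\<lambda>y. 1 / norm (x - (y, 0)) ^ (CARD('m) + 1))"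
proof (rule integrableI_nonneg)
  have t: "snd x > 0" using x by (simp add: half_space_def)
  have "(\<integral>\<^sup>+y. ennreal (1 / norm (x - (y, 0)) ^ (CARD('m) + 1)) \<partial>lborel) =
    ennreal (snd x ^ CARD('m)) * (\<integral>\<^sup>+y. ennreal (1 / norm (snd x *\<^sub>R (y :: real ^ 'm, 1::real)) ^ (CARD('m) + 1)) \<partial>lborel)"
    using x by (rule nn_integral_boundary_affine[rotated]) measurable
  also have "(\<lambda>y. ennreal (1 / norm (snd x *\<^sub>R (y :: real ^ 'm, 1::real)) ^ (CARD('m) + 1))) =
     (\<lambda>y. ennreal (1 / snd x ^ (CARD('m) + 1)) * ennreal (1 / norm (y :: real ^ 'm, 1::real) ^ (CARD('m) + 1)))"
  proof
    fix y :: "real ^ 'm"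
    show "ennreal (1 / norm (snd x *\<^sub>R (y :: real ^ 'm, 1::real)) ^ (CARD('m) + 1)) =
     ennreal (1 / snd x ^ (CARD('m) + 1)) * ennreal (1 / norm (y :: real ^ 'm, 1::real) ^ (CARD('m) + 1))"
      unfolding norm_scaleR using t by (subst ennreal_mult[symmetric]) (auto simp: power_mult_distrib)
  qed
  finally have "(\<integral>\<^sup>+y. ennreal (1 / norm (x - (y, 0)) ^ (CARD('m) + 1)) \<partial>lborel) =
      ennreal (snd x ^ CARD('m)) * (ennreal (1 / snd x ^ (CARD('m) + 1)) * ennreal (omega (CARD('m) + 1) / 2))"
    by (subst (asm) nn_integral_cmult) (measurable, simp only: nn_integral_boundary_kernel)
  also have "\<dots> < \<infinity>"
    by (simp add: ennreal_mult_less_top del: power_Suc)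
  finally show "(\<integral>\<^sup>+y. ennreal (1 / norm (x - (y, 0)) ^ (CARD('m) + 1)) \<partial>lborel) < \<infinity>" .
qed auto

section \<open>Layer integrals: domination, continuity, differentiation\<close>

text \<open>Working substitute for \<open>L_infinity\<close>: the bound holds at every point and
  measurability is Borel, so that neither null sets nor the completion enter the estimates.\<close>

definition bounded_borel :: "('a::euclidean_space \<Rightarrow> real) \<Rightarrow> bool" where
  "bounded_borel f \<longleftrightarrow> f \<in> borel_measurable borel \<and> (\<exists>M. \<forall>y. \<bar>f y\<bar> \<le> M)"

text \<open>The weight \<open>snd w + 1 / snd w\<close> is locally bounded and dominates \<open>snd w\<close>, \<open>1\<close> and \<open>1 / snd w\<close>, the factors
  by which the Poisson kernel, its gradient and its Hessian differ from \<open>1 / norm w ^ n\<close>.\<close>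

definition tame :: "((real ^ 'm) \<times> real \<Rightarrow> 'b::euclidean_space) \<Rightarrow> bool" where
  "tame k \<longleftrightarrow> k \<in> borel_measurable borel \<and> continuous_on half_space k \<and>
    (\<exists>C\<ge>0. \<forall>w\<in>half_space. norm (k w) \<le> C * (snd w + 1 / snd w) / norm w ^ (CARD('m) + 1))"

text \<open>The codomain is a general Euclidean space so that the Poisson kernel, its gradient and
  its Hessian applied to a vector are treated by the same operator. Differentiating a layer means
  differentiating its kernel.\<close>

definition layer :: "(real ^ 'm \<Rightarrow> real) \<Rightarrow> ((real ^ 'm) \<times> real \<Rightarrow> 'b::euclidean_space) \<Rightarrow> (real ^ 'm) \<times> real \<Rightarrow> 'b"
  where "layer f k x = (\<integral>y. f y *\<^sub>R k (x - (y, 0)) \<partial>lborel)"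

text \<open>On the ball around \<open>x\<close> of half its height, heights are comparable to
  \<open>snd x\<close> and distances to boundary points are comparable to those from
  \<open>x\<close>. The majorant therefore depends on \<open>x\<close> only, as dominated
  convergence requires.\<close>

lemma tame_locally_dominated:
  fixes k :: "(real ^ 'm) \<times> real \<Rightarrow> 'b::euclidean_space"
  assumes k: "tame k" and f: "bounded_borel f" and x: "x \<in> half_space"
  obtains B where "\<And>z y. z \<in> ball x (snd x / 2) \<Longrightarrow>
      z \<in> half_space \<and> norm (f y *\<^sub>R k (z - (y, 0))) \<le> B * (1 / norm (x - (y, 0)) ^ (CARD('m) + 1))"
proof -
  let ?N = "CARD('m) + 1"
  obtain C where C: "C \<ge> 0" "\<And>w. w \<in> half_space \<Longrightarrow> norm (k w) \<le> C * (snd w + 1 / snd w) / norm w ^ ?N"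
    using k unfolding tame_def by blast
  obtain M where M: "\<And>y. \<bar>f y\<bar> \<le> M" using f unfolding bounded_borel_def by blast
  have M0: "M \<ge> 0" using M[of undefined] by linarith
  define t where "t = snd x"
  have t: "t > 0" using x by (simp add: t_def half_space_def)
  define S where "S = 2 * t + 2 / t"
  have S: "S > 0" using t by (simp add: S_def add_pos_pos)
  \<comment> \<open>In the witness, \<open>M\<close> bounds \<open>f\<close>, \<open>C\<close> is
    the constant of tameness, \<open>S\<close> bounds the weight on the ball, and the power of 2 is
    the price of replacing \<open>norm (z - (y, 0))\<close> by half of
    \<open>norm (x - (y, 0))\<close>.\<close>
  show ?thesis
  proof (rule that[of "M * (C * S * 2 ^ ?N)"])
    fix z :: "(real ^ 'm) \<times> real" and y :: "real ^ 'm"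
    assume z: "z \<in> ball x (snd x / 2)"
    have d: "norm (x - z) < t / 2" using z by (simp add: dist_norm t_def)
    hence s: "\<bar>t - snd z\<bar> < t / 2" using snd_le_norm[of "x - z"] by (simp add: t_def)
    have sz: "snd z > t / 2" "snd z < 2 * t" using s t by linarith+
    have hz: "z \<in> half_space" using sz t by (simp add: half_space_def)
    have "1 / snd z \<le> 2 / t" using sz t by (simp add: field_simps)
    hence S': "snd z + 1 / snd z \<le> S" using sz by (simp add: S_def)
    have nx: "norm (x - (y, 0)) \<ge> t" using snd_le_norm[of "x - (y,0)"] by (simp add: t_def)
    have "x - (y, 0) = (z - (y, 0)) + (x - z)" by simp
    hence "norm (x - (y, 0)) \<le> norm (z - (y, 0)) + norm (x - z)"
      using norm_triangle_ineq[of "z - (y, 0)" "x - z"] by (simp only:)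
    hence nz: "norm (x - (y, 0)) / 2 \<le> norm (z - (y, 0))" using d nx by linarith
    have pos: "norm (x - (y, 0)) > 0" using nx t by linarith
    have "norm (k (z - (y, 0))) \<le> C * (snd z + 1 / snd z) / norm (z - (y, 0)) ^ ?N"
      using C(2)[of "z - (y, 0)"] hz by simp
    also have "\<dots> \<le> C * S / (norm (x - (y, 0)) / 2) ^ ?N"
      using C(1) S S' nz pos by (intro frac_le mult_left_mono power_mono) auto
    also have "\<dots> = C * S * 2 ^ ?N * (1 / norm (x - (y, 0)) ^ ?N)"
      by (simp add: power_divide)
    finally have "norm (f y *\<^sub>R k (z - (y, 0))) \<le> M * (C * S * 2 ^ ?N * (1 / norm (x - (y, 0)) ^ ?N))"
      unfolding norm_scaleR using M[of y] M0 by (intro mult_mono) auto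
    with hz show "z \<in> half_space \<and> norm (f y *\<^sub>R k (z - (y, 0))) \<le> M * (C * S * 2 ^ ?N) * (1 / norm (x - (y, 0)) ^ ?N)"
      by (simp add: mult.assoc)
  qed
qed

lemma layer_measurable:
  assumes "tame k" "bounded_borel f"
  shows "(\<lambda>y. f y *\<^sub>R k (x - (y, 0))) \<in> borel_measurable borel"
proof -
  have [measurable]: "k \<in> borel_measurable borel" "f \<in> borel_measurable borel"
    using assms by (auto simp: tame_def bounded_borel_def)
  show ?thesis by measurable
qed

lemma layer_integrable:
  fixes k :: "(real ^ 'm) \<times> real \<Rightarrow> 'b::euclidean_space"
  assumes k: "tame k" and f: "bounded_borel f" and x: "x \<in> half_space"
  shows "integrable lborel (\<lambda>y. f y *\<^sub>R k (x - (y, 0)))"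
proof -
  have xb: "x \<in> ball x (snd x / 2)" using x by (simp add: half_space_def)
  obtain B where "\<And>z y. z \<in> ball x (snd x / 2) \<Longrightarrow>
      z \<in> half_space \<and> norm (f y *\<^sub>R k (z - (y, 0))) \<le> B * (1 / norm (x - (y, 0)) ^ (CARD('m) + 1))"
    by (rule tame_locally_dominated[OF k f x]) blast
  hence "norm (f y *\<^sub>R k (x - (y, 0))) \<le> B * (1 / norm (x - (y, 0)) ^ (CARD('m) + 1))" for y
    using xb by blast
  hence bound: "norm (f y *\<^sub>R k (x - (y, 0))) \<le> norm (B * (1 / norm (x - (y, 0)) ^ (CARD('m) + 1)))" for y
    unfolding real_norm_def by (rule order_trans[OF _ abs_ge_self])
  have "integrable lborel (\<lambda>y. B * (1 / norm (x - (y, 0)) ^ (CARD('m) + 1)))"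
    using integrable_boundary_kernel[OF x] by (rule integrable_mult_right)
  moreover have "(\<lambda>y. f y *\<^sub>R k (x - (y, 0))) \<in> borel_measurable lborel"
    using layer_measurable[OF k f, of x] by (simp only: measurable_lborel2)
  ultimately show ?thesis
    by (rule Bochner_Integration.integrable_bound) (rule AE_I2, rule bound)
qed

lemma layer_continuous:
  fixes k :: "(real ^ 'm) \<times> real \<Rightarrow> 'b::euclidean_space"
  assumes k: "tame k" and f: "bounded_borel f"
  shows "continuous_on half_space (layer f k)"
proof (rule continuous_on_sequentiallyI)
  fix X and x :: "(real ^ 'm) \<times> real"
  assume X: "\<forall>n. X n \<in> half_space" "x \<in> half_space" "X \<longlonglongrightarrow> x"
  let ?r = "snd x / 2"
  have r: "?r > 0" using X(2) by (simp add: half_space_def)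
  obtain B where B: "\<And>z y. z \<in> ball x (snd x / 2) \<Longrightarrow>
      z \<in> half_space \<and> norm (f y *\<^sub>R k (z - (y, 0))) \<le> B * (1 / norm (x - (y, 0)) ^ (CARD('m) + 1))"
    by (rule tame_locally_dominated[OF k f X(2)]) blast
  obtain N where N: "\<And>n. n \<ge> N \<Longrightarrow> dist (X n) x < ?r"
    using X(3) r unfolding lim_sequentially by blast
  have "(\<lambda>n. layer f k (X (n + N))) \<longlonglongrightarrow> layer f k x"
    unfolding layer_def
  proof (rule integral_dominated_convergence)
    show "integrable lborel (\<lambda>y. B * (1 / norm (x - (y, 0)) ^ (CARD('m) + 1)))"
      using integrable_boundary_kernel[OF X(2)] by (rule integrable_mult_right)
    show "AE y in lborel. (\<lambda>n. f y *\<^sub>R k (X (n + N) - (y, 0))) \<longlonglongrightarrow> f y *\<^sub>R k (x - (y, 0))"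
    proof (rule AE_I2)
      fix y
      have "continuous_on half_space k" using k by (simp add: tame_def)
      hence "(\<lambda>n. k (X (n + N) - (y, 0))) \<longlonglongrightarrow> k (x - (y, 0))"
      proof (rule continuous_on_tendsto_compose)
        show "(\<lambda>n. X (n + N) - (y, 0)) \<longlonglongrightarrow> x - (y, 0)"
          using X(3) by (intro tendsto_intros LIMSEQ_ignore_initial_segment)
      qed (use X in auto)
      thus "(\<lambda>n. f y *\<^sub>R k (X (n + N) - (y, 0))) \<longlonglongrightarrow> f y *\<^sub>R k (x - (y, 0))"
        by (intro tendsto_intros)
    qed
    show "AE y in lborel. norm (f y *\<^sub>R k (X (n + N) - (y, 0))) \<le> B * (1 / norm (x - (y, 0)) ^ (CARD('m) + 1))" for n
      using B[of "X (n + N)"] N[of "n + N"] by (intro AE_I2) (auto simp: dist_commute)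
  qed (use layer_measurable[OF k f] in auto)
  thus "(\<lambda>n. layer f k (X n)) \<longlonglongrightarrow> layer f k x" by (rule LIMSEQ_offset)
qed

lemma layer_has_derivative:
  fixes k :: "(real ^ 'm) \<times> real \<Rightarrow> real"
  assumes k: "tame k" and k': "tame k'" and f: "bounded_borel f" and x: "x \<in> half_space"
    and der: "\<And>w. w \<in> half_space \<Longrightarrow> (k has_derivative (\<lambda>h. h \<bullet> k' w)) (at w)"
  shows "(layer f k has_derivative (\<lambda>h. h \<bullet> layer f k' x)) (at x)"
proof -
  obtain B where B: "\<And>z y. z \<in> ball x (snd x / 2) \<Longrightarrow>
      z \<in> half_space \<and> norm (f y *\<^sub>R k' (z - (y, 0))) \<le> B * (1 / norm (x - (y, 0)) ^ (CARD('m) + 1))"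
    by (rule tame_locally_dominated[OF k' f x]) blast
  show ?thesis
    unfolding layer_def[abs_def]
  proof (rule has_derivative_integral_dominated[where F' = "\<lambda>z y. f y *\<^sub>R k' (z - (y, 0))"])
    show "snd x / 2 > 0" using x by (simp add: half_space_def)
    show "integrable lborel (\<lambda>y. B * (1 / norm (x - (y, 0)) ^ (CARD('m) + 1)))"
      using integrable_boundary_kernel[OF x] by (rule integrable_mult_right)
    show "(\<lambda>y. f y *\<^sub>R k' (x - (y, 0))) \<in> borel_measurable lborel"
      using layer_measurable[OF k' f] by simp
    fix z assume z: "z \<in> ball x (snd x / 2)"
    hence hz: "z \<in> half_space" using B by blast
    show "integrable lborel (\<lambda>y. f y *\<^sub>R k (z - (y, 0)))"
      using k f hz by (rule layer_integrable)
    fix y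
    show "norm (f y *\<^sub>R k' (z - (y, 0))) \<le> B * (1 / norm (x - (y, 0)) ^ (CARD('m) + 1))"
      using B z by blast
    have "((\<lambda>z. k (z - (y, 0))) has_derivative (\<lambda>h. h \<bullet> k' (z - (y, 0)))) (at z)"
    proof (rule has_derivative_compose[of "\<lambda>z. z - (y, 0)" "\<lambda>h. h"])
      show "((\<lambda>z. z - (y, 0)) has_derivative (\<lambda>h. h)) (at z)"
        by (auto intro!: derivative_eq_intros)
    qed (use hz in \<open>simp only: der half_space_diff_boundary\<close>)
    from has_derivative_scaleR_right[OF this, of "f y"]
    show "((\<lambda>z. f y *\<^sub>R k (z - (y, 0))) has_derivative (\<lambda>h. h \<bullet> f y *\<^sub>R k' (z - (y, 0)))) (at z)"
      by (simp only: inner_scaleR_right real_scaleR_def)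
  qed
qed

subsection \<open>The Poisson kernel and its derivatives\<close>

definition en :: "(real ^ 'm) \<times> real" where "en = (0, 1)"

lemma inner_en: "w \<bullet> en = snd w" "en \<bullet> w = snd w"
  by (simp_all add: en_def inner_prod_def)

lemma norm_en [simp]: "norm en = 1"
  by (simp add: en_def norm_prod_def)

lemma borel_measurable_snd_pair [measurable]:
  "(snd :: 'a::second_countable_topology \<times> 'b::second_countable_topology \<Rightarrow> 'b) \<in> borel \<rightarrow>\<^sub>M borel"
  by (intro borel_measurable_continuous_onI continuous_intros)

text \<open>The Poisson kernel without its constant. The height is written
  \<open>w \<bullet> en\<close> so that all derivatives can be taken without coordinates.\<close>

definition pker :: "(real ^ 'm) \<times> real \<Rightarrow> real" where
  "pker w = (w \<bullet> en) * (1 / norm w ^ (CARD('m) + 1))"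

definition pgrad :: "(real ^ 'm) \<times> real \<Rightarrow> (real ^ 'm) \<times> real" where
  "pgrad w = (1 / norm w ^ (CARD('m) + 1)) *\<^sub>R en
     - (real (CARD('m) + 1) * (w \<bullet> en) * (1 / norm w ^ (CARD('m) + 3))) *\<^sub>R w"

text \<open>The Hessian of \<open>pker\<close> at \<open>w\<close> applied to \<open>b\<close>, that
  is, the gradient of \<open>\<lambda>w. pgrad w \<bullet> b\<close>.\<close>

definition phess :: "(real ^ 'm) \<times> real \<Rightarrow> (real ^ 'm) \<times> real \<Rightarrow> (real ^ 'm) \<times> real" where
  "phess b w = (- real (CARD('m) + 1) * (1 / norm w ^ (CARD('m) + 3))) *\<^sub>R
       ((b \<bullet> en) *\<^sub>R w + (w \<bullet> b) *\<^sub>R en + (w \<bullet> en) *\<^sub>R b)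
     + (real (CARD('m) + 1) * real (CARD('m) + 3) * (w \<bullet> en) * (w \<bullet> b) * (1 / norm w ^ (CARD('m) + 5))) *\<^sub>R w"

lemma has_derivative_inverse_norm_power:
  fixes w :: "'a::euclidean_space"
  assumes "w \<noteq> 0"
  shows "((\<lambda>w. 1 / norm w ^ k) has_derivative (\<lambda>h. - (real k * (h \<bullet> w) * (1 / norm w ^ (k + 2))))) (at w)"
proof (cases k)
  case 0
  then show ?thesis by simp
next
  case (Suc j)
  have "((\<lambda>w. inverse (norm w ^ k)) has_derivative
     (\<lambda>h. - (inverse (norm w ^ k) * (real k * (h \<bullet> sgn w) * norm w ^ (k - 1)) * inverse (norm w ^ k)))) (at w)"
    using assms by (auto intro!: has_derivative_norm derivative_eq_intros)
  moreover have "inverse (norm w ^ k) * (real k * (h \<bullet> sgn w) * norm w ^ (k - 1)) * inverse (norm w ^ k) =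
      real k * (h \<bullet> w) * (1 / norm w ^ (k + 2))" for h
    using assms by (simp add: sgn_div_norm Suc field_simps)
  ultimately show ?thesis by (simp add: inverse_eq_divide)
qed

lemma pker_derivative:
  fixes w :: "(real ^ 'm) \<times> real"
  assumes "w \<in> half_space"
  shows "(pker has_derivative (\<lambda>h. h \<bullet> pgrad w)) (at w)"
proof -
  have w: "w \<noteq> 0" using half_space_nonzero[OF assms] by simp
  have "((\<lambda>w. (w \<bullet> en) * (1 / norm w ^ (CARD('m) + 1))) has_derivative
     (\<lambda>h. (w \<bullet> en) * - (real (CARD('m) + 1) * (h \<bullet> w) * (1 / norm w ^ (CARD('m) + 1 + 2)))
        + (h \<bullet> en) * (1 / norm w ^ (CARD('m) + 1)))) (at w)"
    by (intro has_derivative_mult has_derivative_inverse_norm_power[OF w] has_derivative_inner_left has_derivative_ident)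
  also have "(\<lambda>h. (w \<bullet> en) * - (real (CARD('m) + 1) * (h \<bullet> w) * (1 / norm w ^ (CARD('m) + 1 + 2)))
        + (h \<bullet> en) * (1 / norm w ^ (CARD('m) + 1))) = (\<lambda>h. h \<bullet> pgrad w)"
    by (rule ext) (simp add: pgrad_def inner_diff_right inner_scaleR_right numeral_3_eq_3 algebra_simps)
  finally show ?thesis unfolding pker_def[abs_def] .
qed

lemma pgrad_derivative:
  fixes w :: "(real ^ 'm) \<times> real"
  assumes "w \<in> half_space"
  shows "((\<lambda>w. pgrad w \<bullet> b) has_derivative (\<lambda>h. h \<bullet> phess b w)) (at w)"
proof -
  have w: "w \<noteq> 0" using half_space_nonzero[OF assms] by simp
  let ?N = "real (CARD('m) + 1)"
  have pg: "(\<lambda>w. pgrad w \<bullet> b) = (\<lambda>w. (1 / norm w ^ (CARD('m) + 1)) * (b \<bullet> en) -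
      ?N * ((w \<bullet> en) * (w \<bullet> b)) * (1 / norm w ^ (CARD('m) + 3)))"
    by (rule ext) (simp add: pgrad_def inner_diff_left inner_scaleR_left inner_commute[of en b])
  have "((\<lambda>w. (1 / norm w ^ (CARD('m) + 1)) * (b \<bullet> en) -
      ?N * ((w \<bullet> en) * (w \<bullet> b)) * (1 / norm w ^ (CARD('m) + 3))) has_derivative
     (\<lambda>h. - (?N * (h \<bullet> w) * (1 / norm w ^ (CARD('m) + 1 + 2))) * (b \<bullet> en) -
      (?N * ((w \<bullet> en) * (w \<bullet> b)) * - (real (CARD('m) + 3) * (h \<bullet> w) * (1 / norm w ^ (CARD('m) + 3 + 2))) +
       ?N * ((w \<bullet> en) * (h \<bullet> b) + (h \<bullet> en) * (w \<bullet> b)) * (1 / norm w ^ (CARD('m) + 3))))) (at w)"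
    by (intro has_derivative_diff has_derivative_mult_left has_derivative_mult_right has_derivative_mult
      has_derivative_inverse_norm_power[OF w] has_derivative_inner_left has_derivative_ident)
  also have "(\<lambda>h. - (?N * (h \<bullet> w) * (1 / norm w ^ (CARD('m) + 1 + 2))) * (b \<bullet> en) -
      (?N * ((w \<bullet> en) * (w \<bullet> b)) * - (real (CARD('m) + 3) * (h \<bullet> w) * (1 / norm w ^ (CARD('m) + 3 + 2))) +
       ?N * ((w \<bullet> en) * (h \<bullet> b) + (h \<bullet> en) * (w \<bullet> b)) * (1 / norm w ^ (CARD('m) + 3)))) =
     (\<lambda>h. h \<bullet> phess b w)"
  proof -
    have e: "CARD('m) + 1 + 2 = CARD('m) + 3" "CARD('m) + 3 + 2 = CARD('m) + 5" by simp_all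
    show ?thesis
      unfolding e phess_def inner_add_right inner_scaleR_right
      by (rule ext) (simp only: ring_distribs mult_ac minus_mult_left[symmetric] minus_mult_right[symmetric] minus_minus diff_conv_add_uminus add_ac minus_add_distrib)
  qed
  finally show ?thesis unfolding pg .
qed

lemma half_space_weight:
  assumes "w \<in> half_space"
  shows "1 \<le> snd w + 1 / snd w" "snd w \<le> snd w + 1 / snd w" "1 / snd w \<le> snd w + 1 / snd w"
proof -
  have s: "snd w > 0" using assms by (simp add: half_space_def)
  show "1 \<le> snd w + 1 / snd w"
  proof (cases "snd w \<ge> 1")
    case False
    hence "1 / snd w \<ge> 1" using s by simp
    thus ?thesis using s by linarith
  next
    case True
    moreover have "1 / snd w > 0" using s by simp
    ultimately show ?thesis by linarith
  qed
qed (use assms in \<open>auto simp: half_space_def\<close>)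

lemma tameI:
  fixes k :: "(real ^ 'm) \<times> real \<Rightarrow> 'b::euclidean_space"
  assumes "k \<in> borel_measurable borel" "continuous_on half_space k" "C \<ge> 0"
    and "\<And>w. w \<in> half_space \<Longrightarrow> norm (k w) \<le> C * (1 / norm w ^ (CARD('m) + 1)) * a w"
    and "\<And>w. w \<in> half_space \<Longrightarrow> a w \<le> snd w + 1 / snd w"
  shows "tame k"
  unfolding tame_def
proof (intro conjI exI[of _ C] ballI)
  fix w :: "(real ^ 'm) \<times> real" assume w: "w \<in> half_space"
  have "norm (k w) \<le> C * (1 / norm w ^ (CARD('m) + 1)) * a w" by (rule assms(4)[OF w])
  also have "\<dots> \<le> C * (1 / norm w ^ (CARD('m) + 1)) * (snd w + 1 / snd w)"
    using assms(3,5) w by (intro mult_left_mono) auto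
  finally show "norm (k w) \<le> C * (snd w + 1 / snd w) / norm w ^ (CARD('m) + 1)" by simp
qed (use assms in auto)

lemma tame_pker: "tame (pker :: (real ^ 'm) \<times> real \<Rightarrow> real)"
proof (rule tameI[where C = 1 and a = snd])
  show "pker \<in> borel_measurable borel" unfolding pker_def[abs_def] by measurable
  show "continuous_on half_space (pker :: (real ^ 'm) \<times> real \<Rightarrow> real)"
    unfolding pker_def[abs_def] by (intro continuous_intros) (auto simp: half_space_def zero_prod_def)
qed (use half_space_weight in \<open>auto simp: pker_def inner_en half_space_def\<close>)

lemma tame_pgrad: "tame (pgrad :: (real ^ 'm) \<times> real \<Rightarrow> _)"
proof (rule tameI[where C = "real (CARD('m) + 2)" and a = "\<lambda>_. 1"])
  show "pgrad \<in> borel_measurable borel" unfolding pgrad_def[abs_def] by measurable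
  show "continuous_on half_space (pgrad :: (real ^ 'm) \<times> real \<Rightarrow> _)"
    unfolding pgrad_def[abs_def] by (intro continuous_intros) (auto simp: half_space_def zero_prod_def)
  fix w :: "(real ^ 'm) \<times> real" assume w: "w \<in> half_space"
  define r where "r = norm w"
  have r: "r > 0" using half_space_nonzero[OF w] by (simp add: r_def)
  have "norm (pgrad w) \<le> norm ((1 / r ^ (CARD('m) + 1)) *\<^sub>R (en :: (real ^ 'm) \<times> real)) +
      norm ((real (CARD('m) + 1) * (w \<bullet> en) * (1 / r ^ (CARD('m) + 3))) *\<^sub>R w)"
    unfolding pgrad_def r_def by (rule norm_triangle_ineq4)
  also have "norm ((real (CARD('m) + 1) * (w \<bullet> en) * (1 / r ^ (CARD('m) + 3))) *\<^sub>R w) =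
      real (CARD('m) + 1) * \<bar>w \<bullet> en\<bar> * (1 / r ^ (CARD('m) + 2))"
    using r by (simp add: abs_mult r_def[symmetric] numeral_3_eq_3 numeral_2_eq_2)
  also have "\<dots> \<le> real (CARD('m) + 1) * r * (1 / r ^ (CARD('m) + 2))"
    using snd_le_norm[of w] r by (intro mult_right_mono mult_left_mono) (auto simp: inner_en r_def)
  also have "\<dots> = real (CARD('m) + 1) * (1 / r ^ (CARD('m) + 1))"
    using r by (simp add: numeral_2_eq_2)
  finally show "norm (pgrad w) \<le> real (CARD('m) + 2) * (1 / norm w ^ (CARD('m) + 1)) * 1"
    using r by (simp add: r_def[symmetric] add_divide_distrib algebra_simps)
qed (use half_space_weight in auto)

lemma tame_phess: "tame (phess b :: (real ^ 'm) \<times> real \<Rightarrow> _)"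
proof (rule tameI[where C = "real (CARD('m) + 1) * real (CARD('m) + 6) * norm b" and a = "\<lambda>w. 1 / snd w"])
  show "phess b \<in> borel_measurable borel" unfolding phess_def[abs_def] by measurable
  show "continuous_on half_space (phess b :: (real ^ 'm) \<times> real \<Rightarrow> _)"
    unfolding phess_def[abs_def] by (intro continuous_intros) (auto simp: half_space_def zero_prod_def)
  fix w :: "(real ^ 'm) \<times> real" assume w: "w \<in> half_space"
  define r where "r = norm w"
  let ?N = "real (CARD('m) + 1)"
  have r: "r > 0" using half_space_nonzero[OF w] by (simp add: r_def)
  have en: "\<bar>v \<bullet> en\<bar> \<le> norm v" for v :: "(real ^ 'm) \<times> real" by (simp add: inner_en snd_le_norm)
  have wb: "\<bar>w \<bullet> b\<bar> \<le> r * norm b" unfolding r_def by (rule Cauchy_Schwarz_ineq2)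
  have "norm (phess b w) \<le> norm ((- ?N * (1 / norm w ^ (CARD('m) + 3))) *\<^sub>R
       ((b \<bullet> en) *\<^sub>R w + (w \<bullet> b) *\<^sub>R en + (w \<bullet> en) *\<^sub>R b)) +
     norm ((?N * real (CARD('m) + 3) * (w \<bullet> en) * (w \<bullet> b) * (1 / norm w ^ (CARD('m) + 5))) *\<^sub>R w)"
    unfolding phess_def by (rule norm_triangle_ineq)
  also have "norm ((- ?N * (1 / norm w ^ (CARD('m) + 3))) *\<^sub>R
       ((b \<bullet> en) *\<^sub>R w + (w \<bullet> b) *\<^sub>R en + (w \<bullet> en) *\<^sub>R b)) \<le> ?N * (1 / r ^ (CARD('m) + 3)) * (3 * (r * norm b))"
  proof -
    have "norm ((b \<bullet> en) *\<^sub>R w + (w \<bullet> b) *\<^sub>R en + (w \<bullet> en) *\<^sub>R b) \<le>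
        norm ((b \<bullet> en) *\<^sub>R w) + norm ((w \<bullet> b) *\<^sub>R (en :: (real ^ 'm) \<times> real)) + norm ((w \<bullet> en) *\<^sub>R b)"
      by (meson add_right_mono norm_triangle_ineq order_trans)
    also have "\<dots> = \<bar>b \<bullet> en\<bar> * r + \<bar>w \<bullet> b\<bar> + \<bar>w \<bullet> en\<bar> * norm b" by (simp add: r_def)
    also have "\<dots> \<le> norm b * r + r * norm b + r * norm b"
      using wb en[of b] en[of w] r by (intro add_mono mult_right_mono) (simp_all only: r_def norm_ge_zero)
    finally have *: "norm ((b \<bullet> en) *\<^sub>R w + (w \<bullet> b) *\<^sub>R en + (w \<bullet> en) *\<^sub>R b) \<le> 3 * (r * norm b)" by simp
    have "\<bar>- ?N * (1 / norm w ^ (CARD('m) + 3))\<bar> = ?N * (1 / r ^ (CARD('m) + 3))"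
      using r by (simp add: r_def abs_mult)
    thus ?thesis unfolding norm_scaleR using * r by (simp only:) (intro mult_left_mono, auto)
  qed
  also have "norm ((?N * real (CARD('m) + 3) * (w \<bullet> en) * (w \<bullet> b) * (1 / norm w ^ (CARD('m) + 5))) *\<^sub>R w)
     \<le> ?N * real (CARD('m) + 3) * r * (r * norm b) * (1 / r ^ (CARD('m) + 5)) * r"
    unfolding norm_scaleR abs_mult r_def[symmetric]
    using wb en[of w] r by (intro mult_mono) (auto simp: r_def[symmetric])
  \<comment> \<open>The three terms of the bracket contribute 3 and the last summand
    \<open>CARD('m) + 3\<close>, which add up to \<open>CARD('m) + 6\<close>. The surplus decay
    \<open>1 / r\<close> is then weakened to \<open>1 / snd w\<close> to fit the weight.\<close>
  also have "?N * (1 / r ^ (CARD('m) + 3)) * (3 * (r * norm b)) +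
      ?N * real (CARD('m) + 3) * r * (r * norm b) * (1 / r ^ (CARD('m) + 5)) * r =
      (?N * real (CARD('m) + 6) * norm b) * (1 / r ^ (CARD('m) + 1)) * (1 / r)"
    using r by (simp add: field_simps power_add eval_nat_numeral)
  also have "\<dots> \<le> (?N * real (CARD('m) + 6) * norm b) * (1 / r ^ (CARD('m) + 1)) * (1 / snd w)"
  proof (rule mult_left_mono)
    show "1 / r \<le> 1 / snd w"
      using w snd_le_norm[of w] r by (intro divide_left_mono) (auto simp: half_space_def r_def)
  qed (use r in auto)
  finally show "norm (phess b w) \<le> ?N * real (CARD('m) + 6) * norm b * (1 / norm w ^ (CARD('m) + 1)) * (1 / snd w)"
    by (simp only: r_def)
qed (use half_space_weight in auto)

lemma tame_inner:
  fixes k :: "(real ^ 'm) \<times> real \<Rightarrow> 'b::euclidean_space"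
  assumes "tame k"
  shows "tame (\<lambda>w. k w \<bullet> b)"
proof -
  obtain C where C: "C \<ge> 0" "\<And>w. w \<in> half_space \<Longrightarrow> norm (k w) \<le> C * (snd w + 1 / snd w) / norm w ^ (CARD('m) + 1)"
    using assms unfolding tame_def by blast
  have [measurable]: "k \<in> borel_measurable borel" using assms by (simp add: tame_def)
  show ?thesis
  proof (rule tameI[where C = "C * norm b" and a = "\<lambda>w. snd w + 1 / snd w"])
    show "continuous_on half_space (\<lambda>w. k w \<bullet> b)"
      using assms by (intro continuous_intros) (simp add: tame_def)
    fix w :: "(real ^ 'm) \<times> real" assume w: "w \<in> half_space"
    have "norm (k w \<bullet> b) \<le> norm (k w) * norm b" by (simp add: Cauchy_Schwarz_ineq2)
    also have "\<dots> \<le> C * (snd w + 1 / snd w) / norm w ^ (CARD('m) + 1) * norm b"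
      using C(2)[OF w] by (rule mult_right_mono) simp
    finally show "norm (k w \<bullet> b) \<le> C * norm b * (1 / norm w ^ (CARD('m) + 1)) * (snd w + 1 / snd w)"
      by (simp add: mult_ac)
  qed (use C in auto)
qed

subsection \<open>Poisson integrals\<close>

lemma layer_inner:
  fixes k :: "(real ^ 'm) \<times> real \<Rightarrow> 'b::euclidean_space"
  assumes "tame k" "bounded_borel f" "x \<in> half_space"
  shows "layer f (\<lambda>w. k w \<bullet> b) x = layer f k x \<bullet> b"
proof -
  have "layer f k x \<bullet> b = (\<integral>y. (f y *\<^sub>R k (x - (y, 0))) \<bullet> b \<partial>lborel)"
    unfolding layer_def using layer_integrable[OF assms] by (rule integral_inner_left[symmetric])
  thus ?thesis by (simp add: layer_def)
qed

definition poisson_const :: "'m itself \<Rightarrow> real" where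
  "poisson_const _ = 2 / omega (CARD('m) + 1)"

lemma omega_pos: "k > 0 \<Longrightarrow> omega k > 0"
  by (simp add: omega_def Gamma_real_pos)

lemma poisson_const_pos: "poisson_const TYPE('m::finite) > 0"
  unfolding poisson_const_def by (intro divide_pos_pos omega_pos) auto

lemma poisson_integral_eq_layer:
  fixes f :: "real ^ 'm \<Rightarrow> real"
  assumes "bounded_borel f"
  shows "poisson_integral f x = poisson_const TYPE('m) * layer f pker x"
proof -
  have [measurable]: "f \<in> borel_measurable borel" using assms by (simp add: bounded_borel_def)
  have "(LINT y|lebesgue. snd x / norm ((y, 0) - x) ^ (CARD('m) + 1) * f y) =
      (LINT y|lborel. snd x / norm ((y, 0) - x) ^ (CARD('m) + 1) * f y)"
    by (rule integral_completion) measurable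
  also have "\<dots> = layer f pker x"
    by (simp add: layer_def pker_def inner_en norm_minus_commute mult_ac)
  finally show ?thesis by (simp add: poisson_integral_def poisson_const_def)
qed

lemma poisson_integral_has_derivative:
  fixes f :: "real ^ 'm \<Rightarrow> real"
  assumes f: "bounded_borel f" and x: "x \<in> half_space"
  shows "(poisson_integral f has_derivative
    (\<lambda>h. h \<bullet> (poisson_const TYPE('m) *\<^sub>R layer f pgrad x))) (at x)"
proof -
  have "((\<lambda>x. poisson_const TYPE('m) * layer f pker x) has_derivative
      (\<lambda>h. poisson_const TYPE('m) * (h \<bullet> layer f pgrad x))) (at x)"
    by (intro has_derivative_mult_right layer_has_derivative tame_pker tame_pgrad f x pker_derivative)
  thus ?thesis by (simp add: poisson_integral_eq_layer[OF f, abs_def])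
qed

lemma partial_eqI:
  assumes "(u has_derivative (\<lambda>h. h \<bullet> D)) (at x)"
  shows "partial b u x = D \<bullet> b"
  using frechet_derivative_at[OF assms, symmetric] by (simp add: partial_def inner_commute)

text \<open>A member of \<open>h_infinity\<close> agrees with a Poisson integral on the half-space
  only; openness is what lets derivatives pass from one to the other.\<close>

lemma has_derivative_cong_half_space:
  assumes "(u has_derivative D) (at x)" "x \<in> half_space" "\<And>z. z \<in> half_space \<Longrightarrow> u z = v z"
  shows "(v has_derivative D) (at x)"
  using has_derivative_transform_within_open[OF assms(1) open_half_space assms(2)] assms(3) by blast

text \<open>Harmonicity of the kernel. With s = \<open>w \<bullet> en\<close>, summing the bracket
  over the n basis vectors gives (n + 2) s, and the last summand gives n (n + 2) s
  \<open>w \<bullet> w\<close>; they cancel because \<open>w \<bullet> w\<close> lowers the power of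
  the norm in the denominator by 2.\<close>

lemma trace_phess: "w \<in> half_space \<Longrightarrow> (\<Sum>b\<in>Basis. phess b w \<bullet> b) = 0"
proof -
  assume "w \<in> half_space"
  hence w: "norm w > 0" by (rule half_space_nonzero)
  let ?N = "real (CARD('a) + 1)"
  have B: "(\<Sum>b\<in>Basis. (v \<bullet> b) * (w \<bullet> b)) = v \<bullet> w" for v w :: "(real ^ 'a) \<times> real"
    by (rule euclidean_inner[symmetric])
  have "(\<Sum>b\<in>Basis. phess b w \<bullet> b) =
      (\<Sum>b\<in>Basis. (- ?N * (1 / norm w ^ (CARD('a) + 3))) *
       ((en \<bullet> b) * (w \<bullet> b) + (w \<bullet> b) * (en \<bullet> b) + (w \<bullet> en))
     + (?N * real (CARD('a) + 3) * (w \<bullet> en) * (1 / norm w ^ (CARD('a) + 5))) * ((w \<bullet> b) * (w \<bullet> b)))"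
    by (intro sum.cong refl)
       (simp add: phess_def inner_add_left inner_diff_left inner_commute[of _ en] mult_ac)
  also have "\<dots> = (- ?N * (1 / norm w ^ (CARD('a) + 3))) * ((en \<bullet> w) + (w \<bullet> en) + ?N * (w \<bullet> en))
     + (?N * real (CARD('a) + 3) * (w \<bullet> en) * (1 / norm w ^ (CARD('a) + 5))) * (w \<bullet> w)"
    unfolding sum.distrib sum_distrib_left[symmetric] B by (simp add: B)
  also have "\<dots> = ?N * (w \<bullet> en) * real (CARD('a) + 3) *
      (- (1 / norm w ^ (CARD('a) + 3)) + (w \<bullet> w) * (1 / norm w ^ (CARD('a) + 5)))"
  proof -
    have "(- n * A) * (s + s + n * s) + (n * (n + 2) * s * B) * q = n * s * (n + 2) * (- A + q * B)" for n A s B q :: real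
      by (simp add: algebra_simps)
    moreover have "real (CARD('a) + 3) = ?N + 2" by simp
    ultimately show ?thesis unfolding inner_commute[of en w] by (simp only:)
  qed
  also have "(w \<bullet> w) * (1 / norm w ^ (CARD('a) + 5)) = 1 / norm w ^ (CARD('a) + 3)"
    using w by (simp add: power2_norm_eq_inner[symmetric] power_add eval_nat_numeral)
  finally show ?thesis by simp
qed

text \<open>Serves the sharpness part, where the extremal function has to be shown to belong to
  \<open>h_infinity\<close>.\<close>

lemma harmonic_poisson_integral:
  fixes f :: "real ^ 'm \<Rightarrow> real"
  assumes f: "bounded_borel f"
  shows "harmonic_on half_space (poisson_integral f)"
proof -
  let ?c = "poisson_const TYPE('m)" and ?u = "poisson_integral f"
  have d1: "partial b ?u x = ?c * layer f (\<lambda>w. pgrad w \<bullet> b) x" if "x \<in> half_space" for b x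
    using partial_eqI[OF poisson_integral_has_derivative[OF f that]]
    by (simp add: layer_inner[OF tame_pgrad f that])
  have d2: "(partial b ?u has_derivative (\<lambda>h. h \<bullet> (?c *\<^sub>R layer f (phess b) x))) (at x)"
    if x: "x \<in> half_space" for b x
  proof (rule has_derivative_cong_half_space)
    have "((\<lambda>x. ?c * layer f (\<lambda>w. pgrad w \<bullet> b) x) has_derivative
        (\<lambda>h. ?c * (h \<bullet> layer f (phess b) x))) (at x)"
      by (intro has_derivative_mult_right layer_has_derivative tame_inner tame_pgrad tame_phess f x pgrad_derivative)
    thus "((\<lambda>x. ?c * layer f (\<lambda>w. pgrad w \<bullet> b) x) has_derivative
        (\<lambda>h. h \<bullet> (?c *\<^sub>R layer f (phess b) x))) (at x)" by simp
  qed (use x d1 in auto)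
  have d3: "partial c (partial b ?u) x = ?c * (layer f (phess b) x \<bullet> c)" if "x \<in> half_space" for b c x
    using partial_eqI[OF d2[OF that]] by simp
  show ?thesis
    unfolding harmonic_on_def
  proof (intro conjI ballI)
    fix x :: "(real ^ 'm) \<times> real" assume x: "x \<in> half_space"
    show "?u differentiable at x"
      using poisson_integral_has_derivative[OF f x] unfolding differentiable_def by blast
    show "partial b ?u differentiable at x" for b
      using d2[OF x] unfolding differentiable_def by blast
    have "(\<Sum>b\<in>Basis. partial b (partial b ?u) x) = ?c * (\<Sum>b\<in>Basis. layer f (\<lambda>w. phess b w \<bullet> b) x)"
      by (simp add: d3[OF x] layer_inner[OF tame_phess f x] sum_distrib_left)
    also have "(\<Sum>b\<in>Basis. layer f (\<lambda>w. phess b w \<bullet> b) x) =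
        (\<integral>y. (\<Sum>b\<in>Basis. f y *\<^sub>R (phess b (x - (y, 0)) \<bullet> b)) \<partial>lborel)"
      unfolding layer_def
      by (rule Bochner_Integration.integral_sum[symmetric])
         (rule layer_integrable[OF tame_inner[OF tame_phess] f x])
    also have "\<dots> = 0"
      using x by (simp add: sum_distrib_left[symmetric] trace_phess)
    finally show "(\<Sum>b\<in>Basis. partial b (partial b ?u) x) = 0" by simp
  next
    fix b c :: "(real ^ 'm) \<times> real"
    have "continuous_on half_space (\<lambda>x. ?c * (layer f (phess b) x \<bullet> c))"
      by (intro continuous_intros layer_continuous tame_phess f)
    thus "continuous_on half_space (partial c (partial b ?u))"
      by (rule continuous_on_eq) (simp add: d3)
  qed
qed

text \<open>The kernel is homogeneous of degree \<open>- CARD('m)\<close>, so the powers of the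
  height cancel and the mass is that of the kernel at height 1.\<close>

lemma poisson_integral_one:
  fixes x :: "(real ^ 'm) \<times> real"
  assumes x: "x \<in> half_space"
  shows "poisson_integral (\<lambda>y. 1) x = 1"
proof -
  have t: "snd x > 0" using x by (simp add: half_space_def)
  let ?N = "CARD('m) + 1"
  have bb: "bounded_borel (\<lambda>y :: real ^ 'm. 1)" by (auto simp: bounded_borel_def)
  have [measurable]: "(pker :: (real ^ 'm) \<times> real \<Rightarrow> real) \<in> borel_measurable borel"
    using tame_pker[where 'm = 'm] by (simp add: tame_def)
  have "layer (\<lambda>y. 1) pker x = (\<integral>y. pker (x - (y, 0)) \<partial>lborel)" by (simp add: layer_def)
  also have "\<dots> = enn2real (\<integral>\<^sup>+y. ennreal (pker (x - (y, 0))) \<partial>lborel)"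
    using t by (intro integral_eq_nn_integral) (auto simp: pker_def inner_en)
  also have "(\<integral>\<^sup>+y. ennreal (pker (x - (y, 0))) \<partial>lborel) =
      ennreal (snd x ^ CARD('m)) * (\<integral>\<^sup>+y. ennreal (pker (snd x *\<^sub>R (y :: real ^ 'm, 1))) \<partial>lborel)"
    by (rule nn_integral_boundary_affine[where g = "\<lambda>w. ennreal (pker w)", OF _ x]) measurable
  also have "(\<lambda>y. ennreal (pker (snd x *\<^sub>R (y, 1)))) = (\<lambda>y :: real ^ 'm.
      ennreal (1 / snd x ^ CARD('m)) * ennreal (1 / norm (y, 1::real) ^ ?N))"
  proof
    fix y :: "real ^ 'm"
    have "pker (snd x *\<^sub>R (y, 1)) = 1 / snd x ^ CARD('m) * (1 / norm (y, 1::real) ^ ?N)"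
      unfolding pker_def norm_scaleR using t by (simp add: inner_en power_mult_distrib)
    thus "ennreal (pker (snd x *\<^sub>R (y, 1))) =
        ennreal (1 / snd x ^ CARD('m)) * ennreal (1 / norm (y, 1::real) ^ ?N)"
      using t by (subst ennreal_mult[symmetric]) auto
  qed
  also have "(\<integral>\<^sup>+y. ennreal (1 / snd x ^ CARD('m)) * ennreal (1 / norm (y :: real ^ 'm, 1::real) ^ ?N) \<partial>lborel) =
      ennreal (1 / snd x ^ CARD('m)) * ennreal (omega ?N / 2)"
    by (subst nn_integral_cmult) (measurable, simp only: nn_integral_boundary_kernel)
  also have "ennreal (snd x ^ CARD('m)) * (ennreal (1 / snd x ^ CARD('m)) * ennreal (omega ?N / 2)) = ennreal (omega ?N / 2)"
    using t omega_pos[of ?N] by (simp add: mult.assoc[symmetric] ennreal_mult[symmetric])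
  finally have "layer (\<lambda>y. 1) pker x = omega ?N / 2"
    using omega_pos[of ?N] by simp
  thus ?thesis
    using omega_pos[of ?N] by (simp add: poisson_integral_eq_layer[OF bb] poisson_const_def)
qed

text \<open>The mean-zero property of the gradient kernel, obtained by differentiating the constant
  Poisson integral of 1 instead of integrating the kernel.\<close>

lemma layer_one_pgrad:
  fixes x :: "(real ^ 'm) \<times> real"
  assumes x: "x \<in> half_space"
  shows "layer (\<lambda>y. 1) pgrad x = 0"
proof -
  have bb: "bounded_borel (\<lambda>y :: real ^ 'm. 1)" by (auto simp: bounded_borel_def)
  let ?D = "poisson_const TYPE('m) *\<^sub>R layer (\<lambda>y. 1) pgrad x"
  have "((\<lambda>_. 1::real) has_derivative (\<lambda>h. h \<bullet> ?D)) (at x)"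
    by (rule has_derivative_cong_half_space[OF poisson_integral_has_derivative[OF bb x] x poisson_integral_one])
  hence "(\<lambda>h. h \<bullet> ?D) = (\<lambda>_. 0)"
    by (rule has_derivative_unique) (rule has_derivative_const)
  hence "?D \<bullet> ?D = 0" by metis
  thus ?thesis using poisson_const_pos[where 'm = 'm] by simp
qed

subsection \<open>The vertical direction is extremal\<close>

text \<open>The zero vector is given the direction \<open>en\<close>; hence \<open>l = en\<close>,
  \<open>l = - en\<close> and a vanishing gradient need no separate treatment.\<close>

lemma unit_direction:
  fixes v :: "(real ^ 'm) \<times> real"
  obtains p where "norm p = 1" "v = norm v *\<^sub>R p"
proof (cases "v = 0")
  case True
  then show ?thesis using that[of en] by simp
next
  case False
  then show ?thesis using that[of "sgn v"] by (simp add: norm_sgn sgn_div_norm)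
qed

text \<open>The absolute value of the form of the vertical direction, with its axis moved from
  \<open>en\<close> to \<open>p\<close>.\<close>

definition axial :: "(real ^ 'm) \<times> real \<Rightarrow> (real ^ 'm) \<times> real \<Rightarrow> real" where
  "axial p w = \<bar>w \<bullet> w - real (CARD('m) + 1) * (w \<bullet> p)\<^sup>2\<bar>"

text \<open>What remains of \<open>pgrad w \<bullet> l\<close> after multiplication by
  \<open>norm w ^ (CARD('m) + 3)\<close>. Unlike \<open>pgrad\<close>, it is a polynomial of degree
  2 on the whole space.\<close>

definition pform :: "(real ^ 'm) \<times> real \<Rightarrow> (real ^ 'm) \<times> real \<Rightarrow> real" where
  "pform l w = (en \<bullet> l) * (w \<bullet> w) - real (CARD('m) + 1) * (w \<bullet> en) * (w \<bullet> l)"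

text \<open>Polarisation: the form is diagonal along the bisectors of \<open>en\<close> and \<open>l\<close>.\<close>

lemma pform_le_axial:
  fixes l :: "(real ^ 'm) \<times> real"
  assumes l: "norm l = 1"
  obtains p q a where "norm p = 1" "norm q = 1" "0 \<le> a" "a \<le> 1"
    "\<And>w. \<bar>pform l w\<bar> \<le> a * axial p w + (1 - a) * axial q w"
proof -
  let ?N = "real (CARD('m) + 1)"
  obtain p where p: "norm p = 1" "en + l = norm (en + l) *\<^sub>R p" using unit_direction .
  obtain q where q: "norm q = 1" "en - l = norm (en - l) *\<^sub>R q" using unit_direction .
  define a where "a = (1 + en \<bullet> l) / 2"
  have ll: "l \<bullet> l = 1" "en \<bullet> en = (1 :: real)" using l by (simp_all add: norm_eq_1 inner_en en_def)
  have "\<bar>en \<bullet> l\<bar> \<le> 1" using Cauchy_Schwarz_ineq2[of en l] l by simp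
  hence a: "0 \<le> a" "a \<le> 1" by (auto simp: a_def)
  have np: "(norm (en + l))\<^sup>2 = 4 * a"
    by (simp add: power2_norm_eq_inner inner_add_left inner_add_right ll a_def inner_commute)
  have nq: "(norm (en - l))\<^sup>2 = 4 * (1 - a)"
    by (simp add: power2_norm_eq_inner inner_diff_left inner_diff_right ll a_def inner_commute field_simps)
  have bound: "\<bar>pform l w\<bar> \<le> a * axial p w + (1 - a) * axial q w" for w
  proof -
    have "w \<bullet> (en + l) = norm (en + l) * (w \<bullet> p)" by (subst p(2)) simp
    hence 1: "(w \<bullet> (en + l))\<^sup>2 = 4 * a * (w \<bullet> p)\<^sup>2" by (simp only: power_mult_distrib np)
    have "w \<bullet> (en - l) = norm (en - l) * (w \<bullet> q)" by (subst q(2)) simp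
    hence 2: "(w \<bullet> (en - l))\<^sup>2 = 4 * (1 - a) * (w \<bullet> q)\<^sup>2" by (simp only: power_mult_distrib nq)
    \<comment> \<open>Four times a product is the square of the sum minus the square of the
      difference.\<close>
    have 3: "4 * ((w \<bullet> en) * (w \<bullet> l)) = 4 * a * (w \<bullet> p)\<^sup>2 - 4 * (1 - a) * (w \<bullet> q)\<^sup>2"
      unfolding 1[symmetric] 2[symmetric]
      by (simp add: inner_add_right inner_diff_right power2_eq_square algebra_simps)
    have "pform l w = (2 * a - 1) * (w \<bullet> w) - ?N * ((w \<bullet> en) * (w \<bullet> l))"
    proof -
      have "en \<bullet> l = 2 * a - 1" unfolding a_def by (simp only: times_divide_eq_right) (simp add: field_simps)
      thus ?thesis by (simp add: pform_def)
    qed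
    also have "(w \<bullet> en) * (w \<bullet> l) = a * (w \<bullet> p)\<^sup>2 - (1 - a) * (w \<bullet> q)\<^sup>2"
      using 3 by (simp only: mult.assoc[of 4] right_diff_distrib[symmetric] mult_cancel_left) simp
    \<comment> \<open>Because \<open>2 * a - 1 = a - (1 - a)\<close>, the term
      \<open>w \<bullet> w\<close> splits with the same weights as the two squares.\<close>
    also have "(2 * a - 1) * (w \<bullet> w) - ?N * (a * (w \<bullet> p)\<^sup>2 - (1 - a) * (w \<bullet> q)\<^sup>2) =
      a * (w \<bullet> w - ?N * (w \<bullet> p)\<^sup>2) - (1 - a) * (w \<bullet> w - ?N * (w \<bullet> q)\<^sup>2)"
      by (simp add: algebra_simps)
    also have "\<bar>\<dots>\<bar> \<le> \<bar>a * (w \<bullet> w - ?N * (w \<bullet> p)\<^sup>2)\<bar> + \<bar>(1 - a) * (w \<bullet> w - ?N * (w \<bullet> q)\<^sup>2)\<bar>"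
      by (rule abs_triangle_ineq4)
    also have "\<dots> = a * axial p w + (1 - a) * axial q w"
      unfolding abs_mult axial_def using a by simp
    finally show ?thesis .
  qed
  show ?thesis by (rule that[OF p(1) q(1) a bound])
qed

lemma axial_measurable [measurable]: "axial p \<in> borel_measurable borel"
  unfolding axial_def[abs_def] by measurable

lemma pform_measurable [measurable]: "pform l \<in> borel_measurable borel"
  unfolding pform_def[abs_def] by measurable

lemma nn_integral_ball_axial_cong:
  fixes p q :: "(real ^ 'm) \<times> real"
  assumes "norm p = 1" "norm q = 1"
  shows "(\<integral>\<^sup>+w. ennreal (axial p w) * indicator (ball 0 1) w \<partial>lborel) =
    (\<integral>\<^sup>+w. ennreal (axial q w) * indicator (ball 0 1) w \<partial>lborel)"
proof -
  obtain T where T: "linear T" "\<And>v. norm (T v) = norm v" "\<And>v. T (T v) = v" "T p = q"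
    using reflection_swapping[of p q] assms by metis
  have TT: "T v \<bullet> T w = v \<bullet> w" for v w
    using T(1,2) orthogonal_transformation orthogonal_transformation_def by blast
  have [measurable]: "(ball 0 1 :: ((real ^ 'm) \<times> real) set) \<in> sets borel" by simp
  have "axial p (T w) = axial q w" for w
  proof -
    \<comment> \<open>An isometric involution is self-adjoint, so the axis moves from
      \<open>p\<close> to \<open>T p = q\<close>.\<close>
    have "T w \<bullet> p = w \<bullet> q" using TT[of "T w" p] by (simp add: T)
    thus ?thesis by (simp add: axial_def TT)
  qed
  moreover have "indicator (ball 0 1) (T w) = (indicator (ball 0 1) w :: ennreal)" for w
    by (simp add: indicator_def T)
  moreover have "(\<integral>\<^sup>+w. ennreal (axial p (T w)) * indicator (ball 0 1) (T w) \<partial>lborel) =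
      (\<integral>\<^sup>+w. ennreal (axial p w) * indicator (ball 0 1) w \<partial>lborel)"
    by (rule nn_integral_lborel_involution[OF _ T(1-3)]) measurable
  ultimately show ?thesis by simp
qed

lemma pgrad_inner_eq_pform:
  fixes w :: "(real ^ 'm) \<times> real"
  assumes "w \<in> half_space"
  shows "pgrad w \<bullet> l = pform l w / norm w ^ (CARD('m) + 3)"
proof -
  have w: "norm w > 0" by (rule half_space_nonzero[OF assms])
  have "1 / norm w ^ (CARD('m) + 1) = (w \<bullet> w) / norm w ^ (CARD('m) + 3)"
    using w by (simp add: power2_norm_eq_inner[symmetric] power_add eval_nat_numeral)
  thus ?thesis
    by (simp add: pgrad_def pform_def inner_diff_left inner_scaleR_left diff_divide_distrib mult_ac)
qed

text \<open>For degree 2 the projection divides by the power \<open>CARD('m) + 3\<close> of the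
  norm, which is exactly the denominator of \<open>pgrad\<close>; the projected integrand is the
  gradient kernel itself.\<close>

lemma nn_integral_ball_pform:
  fixes l :: "(real ^ 'm) \<times> real"
  shows "(\<integral>\<^sup>+w. ennreal \<bar>pform l w\<bar> * indicator (ball 0 1) w \<partial>lborel) =
    ennreal (2 / real (CARD('m) + 3)) * (\<integral>\<^sup>+y. ennreal \<bar>pgrad (y, 1) \<bullet> l\<bar> \<partial>lborel)"
proof -
  have hs: "(y, 1) \<in> half_space" for y :: "real ^ 'm" by (simp add: half_space_def)
  have e: "CARD('m) + 1 + 2 = CARD('m) + 3" by simp
  have "(\<integral>\<^sup>+w. ennreal \<bar>pform l w\<bar> * indicator (ball 0 1) w \<partial>lborel) =
      ennreal (2 / real (CARD('m) + 1 + 2)) *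
      (\<integral>\<^sup>+y. ennreal (\<bar>pform l (y, 1)\<bar> / norm (y, 1::real) ^ (CARD('m) + 1 + 2)) \<partial>lborel)"
  proof (rule nn_integral_ball_homogeneous)
    fix s :: real and w :: "(real ^ 'm) \<times> real"
    have "pform l (s *\<^sub>R w) = s\<^sup>2 * pform l w"
      by (simp add: pform_def power2_eq_square algebra_simps)
    thus "\<bar>pform l (s *\<^sub>R w)\<bar> = \<bar>s\<bar> ^ 2 * \<bar>pform l w\<bar>" by (simp add: abs_mult)
  qed auto
  thus ?thesis unfolding e by (simp add: pgrad_inner_eq_pform[OF hs] abs_divide)
qed

lemma nn_integral_pgrad_le_vertical:
  fixes l :: "(real ^ 'm) \<times> real"
  assumes l: "norm l = 1"
  shows "(\<integral>\<^sup>+y. ennreal \<bar>pgrad (y, 1) \<bullet> l\<bar> \<partial>lborel) \<le>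
    (\<integral>\<^sup>+y. ennreal \<bar>pgrad (y :: real ^ 'm, 1) \<bullet> en\<bar> \<partial>lborel)"
proof -
  obtain p q a where pq: "norm p = 1" "norm q = 1" "0 \<le> a" "a \<le> 1"
    and bound: "\<And>w. \<bar>pform l w\<bar> \<le> a * axial p w + (1 - a) * axial q w"
    by (rule pform_le_axial[OF l]) blast
  have [measurable]: "(ball 0 1 :: ((real ^ 'm) \<times> real) set) \<in> sets borel" by simp
  have pen: "\<bar>pform en w\<bar> = axial en w" for w :: "(real ^ 'm) \<times> real"
    by (simp add: pform_def axial_def inner_en power2_eq_square mult.assoc) (simp add: en_def)
  let ?I = "\<lambda>g. \<integral>\<^sup>+w. ennreal (g w) * indicator (ball 0 1) w \<partial>(lborel :: ((real ^ 'm) \<times> real) measure)"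
  have "?I (\<lambda>w. \<bar>pform l w\<bar>) \<le>
    (\<integral>\<^sup>+w. ennreal a * (ennreal (axial p w) * indicator (ball 0 1) w) +
          ennreal (1 - a) * (ennreal (axial q w) * indicator (ball 0 1) w) \<partial>lborel)"
  proof (rule nn_integral_mono)
    fix w
    have "ennreal \<bar>pform l w\<bar> \<le> ennreal (a * axial p w + (1 - a) * axial q w)"
      by (rule ennreal_leI[OF bound])
    also have "\<dots> = ennreal a * ennreal (axial p w) + ennreal (1 - a) * ennreal (axial q w)"
      using pq by (simp add: ennreal_mult axial_def)
    finally show "ennreal \<bar>pform l w\<bar> * indicator (ball 0 1) w \<le>
      ennreal a * (ennreal (axial p w) * indicator (ball 0 1) w) +
          ennreal (1 - a) * (ennreal (axial q w) * indicator (ball 0 1) w)"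
      by (auto simp: indicator_def)
  qed
  also have "\<dots> = ennreal a * ?I (axial p) + ennreal (1 - a) * ?I (axial q)"
    by (subst nn_integral_add) (auto simp: nn_integral_cmult)
  also have "\<dots> = (ennreal a + ennreal (1 - a)) * ?I (axial en)"
    by (simp only: nn_integral_ball_axial_cong[OF pq(1) norm_en] nn_integral_ball_axial_cong[OF pq(2) norm_en] distrib_right)
  also have "ennreal a + ennreal (1 - a) = 1"
    using pq by (simp flip: ennreal_plus)
  finally have "ennreal (2 / real (CARD('m) + 3)) * (\<integral>\<^sup>+y. ennreal \<bar>pgrad (y, 1) \<bullet> l\<bar> \<partial>lborel) \<le>
     ennreal (2 / real (CARD('m) + 3)) * (\<integral>\<^sup>+y. ennreal \<bar>pgrad (y :: real ^ 'm, 1) \<bullet> en\<bar> \<partial>lborel)"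
    by (simp only: nn_integral_ball_pform mult_1_left pen[symmetric])
  thus ?thesis
    by (subst (asm) ennreal_mult_le_mult_iff) auto
qed

text \<open>\<open>pgrad\<close> has degree -n and the substitution on the boundary contributes the
  power n - 1 of the height. What is left is the factor \<open>1 / snd x\<close> of the
  theorem.\<close>

lemma nn_integral_pgrad_scale:
  fixes x :: "(real ^ 'm) \<times> real"
  assumes x: "x \<in> half_space"
  shows "(\<integral>\<^sup>+y. ennreal \<bar>pgrad (x - (y, 0)) \<bullet> l\<bar> \<partial>lborel) =
    ennreal (1 / snd x) * (\<integral>\<^sup>+y. ennreal \<bar>pgrad (y, 1) \<bullet> l\<bar> \<partial>lborel)"
proof -
  have t: "snd x > 0" using x by (simp add: half_space_def)
  have [measurable]: "(pgrad :: (real ^ 'm) \<times> real \<Rightarrow> _) \<in> borel_measurable borel"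
    using tame_pgrad[where 'm = 'm] by (simp add: tame_def)
  have hom: "pgrad (snd x *\<^sub>R w) = (1 / snd x ^ (CARD('m) + 1)) *\<^sub>R pgrad w" for w :: "(real ^ 'm) \<times> real"
  proof -
    have "snd x * (real (CARD('m) + 1) * (snd x * (w \<bullet> en)) * (1 / (snd x * norm w) ^ (CARD('m) + 3))) =
        1 / snd x ^ (CARD('m) + 1) * (real (CARD('m) + 1) * (w \<bullet> en) * (1 / norm w ^ (CARD('m) + 3)))"
      using t by (simp add: power_mult_distrib power_add eval_nat_numeral)
    moreover have "1 / (snd x * norm w) ^ (CARD('m) + 1) =
        1 / snd x ^ (CARD('m) + 1) * (1 / norm w ^ (CARD('m) + 1))"
      by (simp add: power_mult_distrib)
    moreover have "norm (snd x *\<^sub>R w) = snd x * norm w" using t by simp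
    ultimately show ?thesis
      unfolding pgrad_def scaleR_diff_right inner_scaleR_left by (simp only: scaleR_scaleR mult.commute[of _ "snd x"])
  qed
  have "(\<integral>\<^sup>+y. ennreal \<bar>pgrad (x - (y, 0)) \<bullet> l\<bar> \<partial>lborel) =
      ennreal (snd x ^ CARD('m)) * (\<integral>\<^sup>+y. ennreal \<bar>pgrad (snd x *\<^sub>R (y, 1)) \<bullet> l\<bar> \<partial>lborel)"
    by (rule nn_integral_boundary_affine[where g = "\<lambda>w. ennreal \<bar>pgrad w \<bullet> l\<bar>", OF _ x]) measurable
  also have "(\<integral>\<^sup>+y. ennreal \<bar>pgrad (snd x *\<^sub>R (y, 1)) \<bullet> l\<bar> \<partial>lborel) =
      (\<integral>\<^sup>+y. ennreal (1 / snd x ^ (CARD('m) + 1)) * ennreal \<bar>pgrad (y, 1) \<bullet> l\<bar> \<partial>lborel)"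
    unfolding hom using t by (simp add: abs_mult ennreal_mult'[symmetric] del: power_Suc)
  also have "\<dots> = ennreal (1 / snd x ^ (CARD('m) + 1)) * (\<integral>\<^sup>+y. ennreal \<bar>pgrad (y, 1) \<bullet> l\<bar> \<partial>lborel)"
    by (rule nn_integral_cmult) measurable
  also have "ennreal (snd x ^ CARD('m)) * \<dots> = ennreal (1 / snd x) * (\<integral>\<^sup>+y. ennreal \<bar>pgrad (y, 1) \<bullet> l\<bar> \<partial>lborel)"
    unfolding mult.assoc[symmetric] using t by (subst ennreal_mult[symmetric]) auto
  finally show ?thesis .
qed

subsection \<open>The extremal integral\<close>

text \<open>Polar coordinates for radial integrands. The image measure under \<open>norm\<close> is
  determined by its values on the rays \<open>{..a}\<close>, which are volumes of balls, and the
  density is the derivative of these volumes in the radius.\<close>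

lemma distr_norm_lborel:
  "distr (lborel :: 'a::euclidean_space measure) borel norm =
   density lborel (\<lambda>s. ennreal (DIM('a) * unit_ball_vol DIM('a) * s ^ (DIM('a) - 1)) * indicator {0..} s)"
  (is "?M = ?N")
proof (rule measure_eqI_generator_eq[where E = "range (\<lambda>a::real. {..a})" and \<Omega> = UNIV and A = "\<lambda>i. {..real i}"])
  let ?d = "DIM('a)" and ?v = "unit_ball_vol DIM('a)"
  show "Int_stable (range (\<lambda>a::real. {..a}))"
    by (auto simp: Int_stable_def image_iff intro!: exI[of _ "min _ _"])
  show "sets ?M = sigma_sets UNIV (range (\<lambda>a::real. {..a}))"
    "sets ?N = sigma_sets UNIV (range (\<lambda>a::real. {..a}))"
    by (auto simp: borel_eq_atMost)
  have M: "emeasure ?M {..a} = ennreal (?v * max a 0 ^ ?d)" for a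
  proof (cases "a \<ge> 0")
    case True
    have "emeasure ?M {..a} = emeasure lborel (cball (0::'a) a)"
      by (subst emeasure_distr) (auto intro!: arg_cong[where f = "emeasure lborel"])
    thus ?thesis using True by (simp add: emeasure_cball max_def)
  next
    case False
    hence "norm -` {..a} \<inter> space (lborel :: 'a measure) = {}"
      by auto (meson norm_ge_zero order_trans)
    hence "emeasure ?M {..a} = 0"
      by (subst emeasure_distr) auto
    thus ?thesis using False by (simp add: max_def)
  qed
  have N: "emeasure ?N {..a} = ennreal (?v * max a 0 ^ ?d)" for a
  proof (cases "a \<ge> 0")
    case True
    have "emeasure ?N {..a} = (\<integral>\<^sup>+s. ennreal (?d * ?v * s ^ (?d - 1)) * indicator {0..a} s \<partial>lborel)"
      by (subst emeasure_density) (auto intro!: nn_integral_cong simp: indicator_def)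
    also have "\<dots> = ennreal (?v * a ^ ?d - ?v * 0 ^ ?d)"
    proof (rule nn_integral_FTC_Icc)
      show "((\<lambda>s. ?v * s ^ ?d) has_real_derivative ?d * ?v * s ^ (?d - 1)) (at s)" for s
        using DERIV_cmult[OF DERIV_pow[of ?d s], of ?v] by (simp add: mult_ac)
    qed (use True in auto)
    finally show ?thesis using True by (simp add: max_def)
  next
    case False
    have "emeasure ?N {..a} = (\<integral>\<^sup>+s. ennreal (?d * ?v * s ^ (?d - 1)) * indicator {0..} s * indicator {..a} s \<partial>lborel)"
      by (subst emeasure_density) auto
    also have "\<dots> = (\<integral>\<^sup>+s. 0 \<partial>(lborel :: real measure))"
      using False by (intro nn_integral_cong) (auto simp: indicator_def)
    finally have "emeasure ?N {..a} = 0" by simp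
    thus ?thesis using False by (simp add: max_def)
  qed
  show "emeasure ?M X = emeasure ?N X" if "X \<in> range (\<lambda>a::real. {..a})" for X
    using that M N by auto
  show "emeasure ?M {..real i} \<noteq> \<infinity>" for i by (simp add: M)
  show "(\<Union>i. {..real i}) = UNIV" using real_arch_simple by auto
qed auto

lemma nn_integral_radial:
  fixes h :: "real \<Rightarrow> ennreal"
  assumes [measurable]: "h \<in> borel_measurable borel"
  shows "(\<integral>\<^sup>+y. h (norm (y :: 'a::euclidean_space)) \<partial>lborel) =
    (\<integral>\<^sup>+s. ennreal (DIM('a) * unit_ball_vol DIM('a) * s ^ (DIM('a) - 1)) * indicator {0..} s * h s \<partial>lborel)"
proof -
  have "(\<integral>\<^sup>+y. h (norm (y :: 'a)) \<partial>lborel) = (\<integral>\<^sup>+s. h s \<partial>distr (lborel :: 'a measure) borel norm)"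
    by (rule nn_integral_distr[symmetric]) auto
  thus ?thesis
    unfolding distr_norm_lborel by (simp add: nn_integral_density)
qed

text \<open>Direct differentiation shows that \<open>pgrad (y, 1) \<bullet> en\<close> is minus the
  divergence in \<open>y\<close> of the field y / |(y, 1)|^n, where n = m + 1. The function
  differentiated here is the outward flux of the negative of this field through the sphere of radius
  \<open>s\<close>, divided by the area of the unit sphere.\<close>

lemma radial_flux_derivative:
  fixes s :: real
  assumes m: "m > 0"
  shows "((\<lambda>s. - (s ^ m / sqrt (1 + s\<^sup>2) ^ (m + 1))) has_real_derivative
     s ^ (m - 1) * (s\<^sup>2 - real m) / sqrt (1 + s\<^sup>2) ^ (m + 3)) (at s)"
proof -
  define r where "r = sqrt (1 + s\<^sup>2)"
  have r0: "1 + s\<^sup>2 > 0" by (simp add: add_pos_nonneg)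
  hence r: "r > 0" "r * r = 1 + s\<^sup>2" by (simp_all add: r_def)
  obtain j where j: "m = Suc j" using m by (cases m) auto
  have d1: "((\<lambda>s. sqrt (1 + s\<^sup>2)) has_real_derivative s / r) (at s)"
    using r0 by (auto intro!: derivative_eq_intros simp: r_def field_simps)
  have d2: "((\<lambda>s. sqrt (1 + s\<^sup>2) ^ (m + 1)) has_real_derivative real (m + 1) * (s / r) * r ^ m) (at s)"
    using DERIV_power[OF d1, of "m + 1"] by (simp add: r_def mult_ac)
  have "((\<lambda>s. - (s ^ m / sqrt (1 + s\<^sup>2) ^ (m + 1))) has_real_derivative
     - ((real m * s ^ (m - 1) * r ^ (m + 1) - s ^ m * (real (m + 1) * (s / r) * r ^ m))
       / (r ^ (m + 1) * r ^ (m + 1)))) (at s)"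
    using DERIV_minus[OF DERIV_divide[OF DERIV_pow[of m s] d2]] r(1) by (simp add: r_def)
  also have "- ((real m * s ^ (m - 1) * r ^ (m + 1) - s ^ m * (real (m + 1) * (s / r) * r ^ m))
       / (r ^ (m + 1) * r ^ (m + 1))) =
     s ^ (m - 1) * (real (m + 1) * (s * s) - real m * (r * r)) / r ^ (m + 3)"
    using r(1) by (simp add: j field_simps power_add eval_nat_numeral)
  also have "real (m + 1) * (s * s) - real m * (r * r) = s\<^sup>2 - real m"
    unfolding r(2) by (simp add: power2_eq_square algebra_simps)
  finally show ?thesis by (simp only: r_def)
qed

lemma radial_flux_tendsto_0:
  "((\<lambda>s::real. - (s ^ m / sqrt (1 + s\<^sup>2) ^ (m + 1))) \<longlongrightarrow> 0) at_top"
proof -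
  have "((\<lambda>s::real. s ^ m / sqrt (1 + s\<^sup>2) ^ (m + 1)) \<longlongrightarrow> 0) at_top"
  proof (rule tendsto_sandwich[of "\<lambda>_. 0" _ _ "\<lambda>s. 1 / s"])
    show "eventually (\<lambda>s::real. 0 \<le> s ^ m / sqrt (1 + s\<^sup>2) ^ (m + 1)) at_top"
      using eventually_gt_at_top[of 0] by eventually_elim simp
    show "eventually (\<lambda>s::real. s ^ m / sqrt (1 + s\<^sup>2) ^ (m + 1) \<le> 1 / s) at_top"
      using eventually_gt_at_top[of 0]
    proof eventually_elim
      case (elim s)
      have "s \<le> sqrt (1 + s\<^sup>2)" by (rule real_le_rsqrt) simp
      hence "s ^ m / sqrt (1 + s\<^sup>2) ^ (m + 1) \<le> s ^ m / s ^ (m + 1)"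
        using elim add_pos_nonneg[OF zero_less_one zero_le_power2[of s]]
        by (intro divide_left_mono power_mono mult_pos_pos zero_less_power) auto
      also have "\<dots> = 1 / s" using elim by simp
      finally show ?case .
    qed
    show "((\<lambda>s::real. 1 / s) \<longlongrightarrow> 0) at_top"
      by (rule tendsto_divide_0[OF tendsto_const filterlim_at_top_imp_at_infinity[OF filterlim_ident]])
  qed auto
  from tendsto_minus[OF this] show ?thesis by simp
qed

text \<open>Shows that the kernel is radial and changes sign where
  \<open>norm y = sqrt CARD('m)\<close>.\<close>

lemma vertical_pgrad_eq:
  fixes y :: "real ^ 'm"
  shows "pgrad (y, 1) \<bullet> en = ((norm y)\<^sup>2 - real CARD('m)) / sqrt (1 + (norm y)\<^sup>2) ^ (CARD('m) + 3)"
proof -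
  have hs: "(y, 1) \<in> half_space" by (simp add: half_space_def)
  have "norm (y, 1::real) = sqrt (1 + (norm y)\<^sup>2)" by (simp add: norm_prod_def add.commute)
  moreover have "pform en (y, 1::real) = (norm y)\<^sup>2 - real CARD('m)"
    by (simp add: pform_def inner_en inner_prod_def power2_norm_eq_inner) (simp add: en_def)
  ultimately show ?thesis by (simp add: pgrad_inner_eq_pform[OF hs])
qed

text \<open>\<open>ennreal\<close> truncates negative values to 0, so this is the mass of the
  positive part, which lives on \<open>norm y \<ge> sqrt CARD('m)\<close>.\<close>

lemma nn_integral_vertical_pgrad_pos:
  "(\<integral>\<^sup>+y. ennreal (pgrad (y :: real ^ 'm, 1) \<bullet> en) \<partial>lborel) =
    ennreal (omega CARD('m) * sqrt CARD('m) ^ CARD('m) / sqrt (CARD('m) + 1) ^ (CARD('m) + 1))"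
proof -
  let ?m = "CARD('m)" and ?V = "real CARD('m) * unit_ball_vol CARD('m)"
  let ?F = "\<lambda>s::real. - (s ^ ?m / sqrt (1 + s\<^sup>2) ^ (?m + 1))"
  let ?f = "\<lambda>s::real. s ^ (?m - 1) * (s\<^sup>2 - real ?m) / sqrt (1 + s\<^sup>2) ^ (?m + 3)"
  let ?h = "\<lambda>s::real. (s\<^sup>2 - real ?m) / sqrt (1 + s\<^sup>2) ^ (?m + 3)"
  have V: "?V \<ge> 0" by (simp add: unit_ball_vol_nonneg)
  have "(\<integral>\<^sup>+y. ennreal (pgrad (y :: real ^ 'm, 1) \<bullet> en) \<partial>lborel) =
      (\<integral>\<^sup>+y. ennreal (?h (norm (y :: real ^ 'm))) \<partial>lborel)"
    by (simp only: vertical_pgrad_eq)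
  also have "\<dots> = (\<integral>\<^sup>+s. ennreal (?V * s ^ (?m - 1)) * indicator {0..} s * ennreal (?h s) \<partial>lborel)"
    by (subst nn_integral_radial) auto
  also have "\<dots> = (\<integral>\<^sup>+s. ennreal ?V * (ennreal (?f s) * indicator {sqrt ?m..} s) \<partial>lborel)"
  proof (rule nn_integral_cong)
    fix s :: real
    consider "s < 0" | "0 \<le> s" "s < sqrt ?m" | "sqrt ?m \<le> s" by linarith
    thus "ennreal (?V * s ^ (?m - 1)) * indicator {0..} s * ennreal (?h s) =
        ennreal ?V * (ennreal (?f s) * indicator {sqrt ?m..} s)"
    proof cases
      case 1
      moreover have "\<not> sqrt ?m \<le> s" using 1 by (smt (verit) real_sqrt_ge_zero of_nat_0_le_iff)
      ultimately show ?thesis by simp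
    next
      case 2
      hence "s\<^sup>2 < (sqrt ?m)\<^sup>2" by (intro power_strict_mono) auto
      hence "?h s \<le> 0" by (intro divide_nonpos_nonneg) auto
      thus ?thesis using 2 by (simp add: ennreal_neg)
    next
      case 3
      hence s: "s \<ge> 0" by (smt (verit) real_sqrt_ge_zero of_nat_0_le_iff)
      have "(sqrt ?m)\<^sup>2 \<le> s\<^sup>2" using 3 by (intro power_mono) auto
      hence "?h s \<ge> 0" by (intro divide_nonneg_nonneg) auto
      hence "ennreal (?V * s ^ (?m - 1)) * ennreal (?h s) = ennreal ((?V * s ^ (?m - 1)) * ?h s)"
        using s V by (intro ennreal_mult[symmetric]) auto
      also have "(?V * s ^ (?m - 1)) * ?h s = ?V * ?f s" by simp
      also have "ennreal \<dots> = ennreal ?V * ennreal (?f s)"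
        by (rule ennreal_mult'[OF V])
      finally show ?thesis using 3 s by simp
    qed
  qed
  also have "\<dots> = ennreal ?V * (\<integral>\<^sup>+s. ennreal (?f s) * indicator {sqrt ?m..} s \<partial>lborel)"
    by (rule nn_integral_cmult) measurable
  \<comment> \<open>The flux vanishes at infinity. At the lower limit \<open>1 + s\<^sup>2\<close>
    equals \<open>?m + 1\<close>, the dimension n, which is how n^(n/2) enters the constant.\<close>
  also have "(\<integral>\<^sup>+s. ennreal (?f s) * indicator {sqrt ?m..} s \<partial>lborel) = ennreal (0 - ?F (sqrt ?m))"
  proof (rule nn_integral_FTC_atLeast)
    fix s :: real assume s: "sqrt ?m \<le> s"
    show "(?F has_real_derivative ?f s) (at s)" by (rule radial_flux_derivative) simp
    have "s \<ge> 0" using s by (smt (verit) real_sqrt_ge_zero of_nat_0_le_iff)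
    moreover have "(sqrt ?m)\<^sup>2 \<le> s\<^sup>2" using s by (intro power_mono) auto
    ultimately show "0 \<le> ?f s" by (intro divide_nonneg_nonneg mult_nonneg_nonneg) auto
  qed (use radial_flux_tendsto_0 in auto)
  also have "ennreal ?V * ennreal (0 - ?F (sqrt ?m)) = ennreal (?V * (sqrt ?m ^ ?m / sqrt (?m + 1) ^ (?m + 1)))"
    by (subst ennreal_mult'[OF V]) (simp add: add.commute)
  also have "?V = omega ?m" by (rule omega_eq_unit_ball_vol[symmetric]) simp
  finally show ?thesis by simp
qed

subsection \<open>Poisson integrals of bounded functions\<close>

lemma grad_eqI:
  assumes "(u has_derivative (\<lambda>h. h \<bullet> D)) (at x)"
  shows "grad u x = D"
  unfolding grad_def gderiv_def
proof (rule the_equality)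
  show "(u has_derivative (\<lambda>h. h \<bullet> D)) (at x)" by fact
  fix E assume "(u has_derivative (\<lambda>h. h \<bullet> E)) (at x)"
  hence "(\<lambda>h. h \<bullet> E) = (\<lambda>h. h \<bullet> D)" using assms by (rule has_derivative_unique)
  hence "(E - D) \<bullet> E = (E - D) \<bullet> D" by metis
  hence "(E - D) \<bullet> (E - D) = 0" by (simp add: inner_diff_right)
  thus "E = D" by simp
qed

lemma pgrad_borel [measurable]: "(pgrad :: (real ^ 'm) \<times> real \<Rightarrow> _) \<in> borel_measurable borel"
  using tame_pgrad[where 'm = 'm] by (simp add: tame_def)

lemma pker_borel [measurable]: "(pker :: (real ^ 'm) \<times> real \<Rightarrow> real) \<in> borel_measurable borel"
  using tame_pker[where 'm = 'm] by (simp add: tame_def)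

lemma bounded_borel_one: "bounded_borel (\<lambda>y. 1)"
  by (auto simp: bounded_borel_def)

text \<open>A Borel function equal to \<open>f\<close> almost everywhere is set to 0 where it
  exceeds the essential bound; both changes concern null sets and leave the Poisson integral as it
  is.\<close>

lemma L_infinity_representative:
  fixes f :: "real ^ 'm \<Rightarrow> real"
  assumes "f \<in> L_infinity"
  obtains g where "bounded_borel g" "\<And>x. poisson_integral f x = poisson_integral g x"
proof -
  from assms obtain M where f: "f \<in> borel_measurable lebesgue" and M: "AE y in lebesgue. \<bar>f y\<bar> \<le> M"
    by (auto simp: L_infinity_def)
  obtain h where h: "h \<in> borel_measurable lborel" "AE y in lborel. f y = h y"
    using completion_ex_borel_measurable_real[OF f] by blast
  define g where "g y = (if \<bar>h y\<bar> \<le> M then h y else 0)" for y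
  have [measurable]: "h \<in> borel_measurable borel" using h by simp
  have gb: "g \<in> borel_measurable borel" unfolding g_def[abs_def] by measurable
  \<comment> \<open>The outer absolute value covers a negative \<open>M\<close>, for which
    \<open>g\<close> would be 0 everywhere.\<close>
  moreover have "\<bar>g y\<bar> \<le> \<bar>M\<bar>" for y by (auto simp: g_def)
  ultimately have g: "bounded_borel g" unfolding bounded_borel_def by blast
  have "AE y in lebesgue. f y = h y" using h(2) by (rule AE_completion)
  with M have fg: "AE y in lebesgue. f y = g y"
    by eventually_elim (auto simp: g_def)
  have gl: "g \<in> borel_measurable lebesgue"
    using gb by (intro measurable_completion) simp
  have "poisson_integral f x = poisson_integral g x" for x
  proof -
    have "(\<lambda>y. snd x / norm ((y, 0) - x) ^ (CARD('m) + 1)) \<in> borel_measurable lborel"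
      by measurable
    hence k: "(\<lambda>y. snd x / norm ((y, 0) - x) ^ (CARD('m) + 1)) \<in> borel_measurable lebesgue"
      by (rule measurable_completion)
    have "(LINT y|lebesgue. snd x / norm ((y, 0) - x) ^ (CARD('m) + 1) * f y) =
      (LINT y|lebesgue. snd x / norm ((y, 0) - x) ^ (CARD('m) + 1) * g y)"
      using fg by (intro integral_cong_AE borel_measurable_times k f gl) auto
    thus ?thesis by (simp add: poisson_integral_def)
  qed
  with g that show ?thesis by blast
qed

lemma bounded_borel_in_L_infinity:
  assumes "bounded_borel f"
  shows "f \<in> L_infinity"
  using assms unfolding bounded_borel_def L_infinity_def
  by (auto intro!: measurable_completion)

text \<open>The Poisson kernel is nonnegative with total mass 1, so \<open>u\<close> takes averages
  of \<open>f\<close>.\<close>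

lemma poisson_integral_bounds:
  fixes f :: "real ^ 'm \<Rightarrow> real"
  assumes f: "bounded_borel f" and ab: "\<And>y. a \<le> f y" "\<And>y. f y \<le> b" and x: "x \<in> half_space"
  shows "a \<le> poisson_integral f x" "poisson_integral f x \<le> b"
proof -
  have c: "poisson_const TYPE('m) > 0" by (rule poisson_const_pos)
  have one: "poisson_const TYPE('m) * layer (\<lambda>_. 1) pker x = 1"
    using poisson_integral_one[OF x] poisson_integral_eq_layer[OF bounded_borel_one, of x] by simp
  have pos: "pker (x - (y, 0)) \<ge> 0" for y
    using x by (simp add: pker_def inner_en half_space_def)
  note int = layer_integrable[OF tame_pker _ x, unfolded real_scaleR_def]
  have "a * layer (\<lambda>_. 1) pker x \<le> layer f pker x"
    unfolding layer_def integral_mult_right_zero[symmetric] real_scaleR_def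
    using int[OF f] int[OF bounded_borel_one] ab pos by (intro integral_mono integrable_mult_right) (auto intro: mult_right_mono)
  from mult_left_mono[OF this, of "poisson_const TYPE('m)"] c one
  show "a \<le> poisson_integral f x"
    by (simp add: poisson_integral_eq_layer[OF f] mult.left_commute[of _ a])
  have "layer f pker x \<le> b * layer (\<lambda>_. 1) pker x"
    unfolding layer_def integral_mult_right_zero[symmetric] real_scaleR_def
    using int[OF f] int[OF bounded_borel_one] ab pos by (intro integral_mono integrable_mult_right) (auto intro: mult_right_mono)
  from mult_left_mono[OF this, of "poisson_const TYPE('m)"] c one
  show "poisson_integral f x \<le> b"
    by (simp add: poisson_integral_eq_layer[OF f] mult.left_commute[of _ b])
qed

lemma poisson_slice_bounded_borel:
  fixes f :: "real ^ 'm \<Rightarrow> real"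
  assumes f: "bounded_borel f" and d: "d > 0"
  shows "bounded_borel (\<lambda>y. poisson_integral f (y, d))"
proof -
  obtain M where M: "\<And>y. \<bar>f y\<bar> \<le> M" using f by (auto simp: bounded_borel_def)
  have hs: "(y, d) \<in> half_space" for y :: "real ^ 'm" using d by (simp add: half_space_def)
  have "\<bar>poisson_integral f (y, d)\<bar> \<le> M" for y
    using poisson_integral_bounds[OF f _ _ hs, of "- M" M y] M by (auto simp: abs_le_iff minus_le_iff)
  moreover have "(\<lambda>y. poisson_integral f (y, d)) \<in> borel_measurable borel"
  proof (rule borel_measurable_continuous_onI)
    have "continuous_on half_space (\<lambda>x. poisson_const TYPE('m) * layer f pker x)"
      by (intro continuous_intros layer_continuous tame_pker f)
    from continuous_on_compose2[OF this, of UNIV "\<lambda>y. (y, d)"]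
    show "continuous_on UNIV (\<lambda>y. poisson_integral f (y, d))"
      using hs by (simp add: poisson_integral_eq_layer[OF f] image_subset_iff continuous_on_Pair)
  qed
  ultimately show ?thesis unfolding bounded_borel_def by blast
qed

definition pgrad_mass :: "(real ^ 'm) \<times> real \<Rightarrow> (real ^ 'm) \<times> real \<Rightarrow> real" where
  "pgrad_mass l x = (\<integral>y. \<bar>pgrad (x - (y, 0)) \<bullet> l\<bar> \<partial>lborel)"

lemma integrable_pgrad_inner:
  "x \<in> half_space \<Longrightarrow> integrable lborel (\<lambda>y. pgrad (x - (y, 0)) \<bullet> l)"
  using layer_integrable[OF tame_inner[OF tame_pgrad] bounded_borel_one, of x l] by simp

lemma ennreal_pgrad_mass:
  fixes x :: "(real ^ 'm) \<times> real"
  assumes x: "x \<in> half_space"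
  shows "ennreal (pgrad_mass l x) = ennreal (1 / snd x) * (\<integral>\<^sup>+y. ennreal \<bar>pgrad (y, 1) \<bullet> l\<bar> \<partial>lborel)"
  unfolding pgrad_mass_def nn_integral_pgrad_scale[OF x, symmetric]
  using integrable_pgrad_inner[OF x, of l] by (intro nn_integral_eq_integral[symmetric]) auto

text \<open>The mass of the positive part of the vertical kernel at height 1, hence half of its
  total mass.\<close>

definition half_mass :: "'m itself \<Rightarrow> real" where
  "half_mass _ = omega CARD('m) * sqrt CARD('m) ^ CARD('m) / sqrt (CARD('m) + 1) ^ (CARD('m) + 1)"

lemma half_mass_pos: "half_mass TYPE('m::finite) > 0"
  unfolding half_mass_def using omega_pos[of "CARD('m)"] by (intro divide_pos_pos mult_pos_pos) auto

text \<open>Mean zero makes the negative part as heavy as the positive part, whose mass is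
  known.\<close>

lemma nn_integral_vertical_pgrad:
  "(\<integral>\<^sup>+y. ennreal \<bar>pgrad (y :: real ^ 'm, 1) \<bullet> en\<bar> \<partial>lborel) = ennreal (2 * half_mass TYPE('m))"
proof -
  let ?g = "\<lambda>y :: real ^ 'm. pgrad (y, 1) \<bullet> en"
  have hs: "(en :: (real ^ 'm) \<times> real) \<in> half_space" by (simp add: half_space_def en_def)
  have refl: "pgrad (en - (y, 0)) \<bullet> en = ?g y" for y :: "real ^ 'm"
  proof -
    have "en - (y, 0) = (- y, 1)" by (simp add: en_def)
    thus ?thesis by (simp only: vertical_pgrad_eq norm_minus_cancel)
  qed
  have int: "integrable lborel ?g"
    using integrable_pgrad_inner[OF hs, of en] by (simp only: refl)
  have "(\<integral>y. ?g y \<partial>lborel) = layer (\<lambda>_. 1) (\<lambda>w. pgrad w \<bullet> en) (en :: (real ^ 'm) \<times> real)"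
    by (simp add: layer_def refl)
  also have "\<dots> = 0"
    by (simp add: layer_inner[OF tame_pgrad bounded_borel_one hs] layer_one_pgrad[OF hs])
  finally have "enn2real (\<integral>\<^sup>+y. ennreal (?g y) \<partial>lborel) = enn2real (\<integral>\<^sup>+y. ennreal (- ?g y) \<partial>lborel)"
    by (simp add: real_lebesgue_integral_def[OF int])
  moreover have "(\<integral>\<^sup>+y. ennreal (?g y) \<partial>lborel) = ennreal (half_mass TYPE('m))"
    unfolding half_mass_def by (rule nn_integral_vertical_pgrad_pos)
  \<comment> \<open>The balance of the two parts is so far an equation between
    \<open>enn2real\<close> values, and \<open>enn2real\<close> sends \<open>top\<close> to 0;
    finiteness lifts it back to \<open>ennreal\<close>.\<close>
  moreover have "(\<integral>\<^sup>+y. ennreal (- ?g y) \<partial>lborel) < top"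
    using integrableD(3)[OF int] by (simp add: less_top)
  ultimately have neg: "(\<integral>\<^sup>+y. ennreal (- ?g y) \<partial>lborel) = ennreal (half_mass TYPE('m))"
    using half_mass_pos[where 'm = 'm] by (metis enn2real_ennreal ennreal_enn2real less_eq_real_def)
  have "ennreal \<bar>?g y\<bar> = ennreal (?g y) + ennreal (- ?g y)" for y
    by (cases "?g y \<ge> 0") (auto simp: ennreal_neg)
  hence "(\<integral>\<^sup>+y. ennreal \<bar>?g y\<bar> \<partial>lborel) = (\<integral>\<^sup>+y. ennreal (?g y) \<partial>lborel) + (\<integral>\<^sup>+y. ennreal (- ?g y) \<partial>lborel)"
    by (simp add: nn_integral_add)
  also have "\<dots> = ennreal (half_mass TYPE('m)) + ennreal (half_mass TYPE('m))"
    unfolding neg by (simp only: nn_integral_vertical_pgrad_pos half_mass_def)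
  also have "\<dots> = ennreal (2 * half_mass TYPE('m))"
    using half_mass_pos[where 'm = 'm] by (subst ennreal_plus[symmetric]) auto
  finally show ?thesis .
qed

lemma pgrad_mass_le:
  fixes x :: "(real ^ 'm) \<times> real"
  assumes x: "x \<in> half_space" and l: "norm l = 1"
  shows "pgrad_mass l x \<le> 2 * half_mass TYPE('m) / snd x"
proof -
  have t: "snd x > 0" using x by (simp add: half_space_def)
  have "ennreal (pgrad_mass l x) \<le> ennreal (1 / snd x) * ennreal (2 * half_mass TYPE('m))"
    unfolding ennreal_pgrad_mass[OF x] nn_integral_vertical_pgrad[symmetric]
    by (intro mult_left_mono nn_integral_pgrad_le_vertical l) auto
  also have "\<dots> = ennreal (2 * half_mass TYPE('m) / snd x)"
    using t half_mass_pos[where 'm = 'm] by (subst ennreal_mult[symmetric]) auto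
  finally show ?thesis
    using t half_mass_pos[where 'm = 'm] by (subst (asm) ennreal_le_iff) auto
qed

lemma pgrad_mass_vertical:
  fixes x :: "(real ^ 'm) \<times> real"
  assumes x: "x \<in> half_space"
  shows "pgrad_mass en x = 2 * half_mass TYPE('m) / snd x"
proof -
  have t: "snd x > 0" using x by (simp add: half_space_def)
  have "ennreal (pgrad_mass en x) = ennreal (1 / snd x) * ennreal (2 * half_mass TYPE('m))"
    unfolding ennreal_pgrad_mass[OF x] nn_integral_vertical_pgrad ..
  also have "\<dots> = ennreal (2 * half_mass TYPE('m) / snd x)"
    using t half_mass_pos[where 'm = 'm] by (subst ennreal_mult[symmetric]) auto
  finally show ?thesis
    using t half_mass_pos[where 'm = 'm] by (subst (asm) ennreal_inj) (auto simp: pgrad_mass_def)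
qed

text \<open>The kernel has mean zero, so \<open>b\<close> may be subtracted from \<open>g\<close>.
  With \<open>b\<close> the midpoint of the range, \<open>r\<close> is half the oscillation, and
  this is the factor one half in the estimate.\<close>

lemma layer_pgrad_oscillation:
  fixes g :: "real ^ 'm \<Rightarrow> real"
  assumes g: "bounded_borel g" and x: "x \<in> half_space" and r: "\<And>y. \<bar>g y - b\<bar> \<le> r"
  shows "\<bar>layer g (\<lambda>w. pgrad w \<bullet> l) x\<bar> \<le> r * pgrad_mass l x"
proof -
  let ?k = "\<lambda>y. pgrad (x - (y, 0)) \<bullet> l"
  have intg: "integrable lborel (\<lambda>y. g y * ?k y)"
    using layer_integrable[OF tame_inner[OF tame_pgrad] g x, of l] by simp
  have int: "integrable lborel ?k" by (rule integrable_pgrad_inner[OF x])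
  have "layer (\<lambda>_. 1) (\<lambda>w. pgrad w \<bullet> l) x = 0"
    by (simp add: layer_inner[OF tame_pgrad bounded_borel_one x] layer_one_pgrad[OF x])
  hence "(\<integral>y. ?k y \<partial>lborel) = 0" by (simp add: layer_def)
  hence "layer g (\<lambda>w. pgrad w \<bullet> l) x = (\<integral>y. g y * ?k y - b * ?k y \<partial>lborel)"
    using intg int by (simp add: layer_def)
  also have "\<bar>\<dots>\<bar> \<le> (\<integral>y. \<bar>g y * ?k y - b * ?k y\<bar> \<partial>lborel)"
    by (rule integral_abs_bound)
  also have "\<dots> \<le> (\<integral>y. r * \<bar>?k y\<bar> \<partial>lborel)"
  proof (rule integral_mono)
    show "integrable lborel (\<lambda>y. \<bar>g y * ?k y - b * ?k y\<bar>)"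
      using intg int by (intro integrable_abs Bochner_Integration.integrable_diff integrable_mult_right)
    show "integrable lborel (\<lambda>y. r * \<bar>?k y\<bar>)"
      using int by (intro integrable_mult_right integrable_abs)
    show "\<bar>g y * ?k y - b * ?k y\<bar> \<le> r * \<bar>?k y\<bar>" for y
      unfolding left_diff_distrib[symmetric] abs_mult by (intro mult_right_mono r) simp
  qed
  finally show ?thesis by (simp add: pgrad_mass_def)
qed

section \<open>Mollification: from the boundary function to the values of \<open>u\<close> in the
  half-space\<close>

text \<open>Both sides are the double integral of the kernel at height \<open>d\<close> in
  \<open>w\<close>, of \<open>f (w + y)\<close> and of the gradient kernel in \<open>y\<close>.
  Integrating in \<open>y\<close> inside gives derivatives at horizontally shifted points;
  integrating in \<open>w\<close> inside gives the slice of the Poisson integral at height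
  \<open>d\<close>.\<close>

lemma layer_pgrad_mollified:
  fixes f :: "real ^ 'm \<Rightarrow> real"
  assumes f: "bounded_borel f" and x: "x \<in> half_space" and d: "d > 0"
  shows "(\<integral>w. poisson_const TYPE('m) * pker ((0, d) - (w, 0)) * layer f (\<lambda>v. pgrad v \<bullet> l) (x + (w, 0)) \<partial>lborel) =
    layer (\<lambda>y. poisson_integral f (y, d)) (\<lambda>v. pgrad v \<bullet> l) x"
proof -
  let ?c = "poisson_const TYPE('m)"
  let ?P = "\<lambda>w :: real ^ 'm. ?c * pker ((0, d) - (w, 0))"
  let ?k = "\<lambda>y. pgrad (x - (y, 0)) \<bullet> l"
  have [measurable]: "f \<in> borel_measurable borel" using f by (simp add: bounded_borel_def)
  obtain M where M: "\<And>y. \<bar>f y\<bar> \<le> M" using f by (auto simp: bounded_borel_def)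
  have hd: "(0 :: real ^ 'm, d) \<in> half_space" using d by (simp add: half_space_def)
  have intP: "integrable lborel ?P"
    using layer_integrable[OF tame_pker bounded_borel_one hd] by simp
  have intk: "integrable lborel ?k" by (rule integrable_pgrad_inner[OF x])
  have prod: "integrable (lborel \<Otimes>\<^sub>M lborel) (\<lambda>(w, y). M * (?P w * ?k y))"
  proof (rule lborel_pair.Fubini_integrable)
    show "(\<lambda>(w, y). M * (?P w * ?k y)) \<in> borel_measurable (lborel \<Otimes>\<^sub>M lborel)"
      by measurable
    have "(\<lambda>w. \<integral>y. norm (case (w, y) of (w, y) \<Rightarrow> M * (?P w * ?k y)) \<partial>lborel) =
        (\<lambda>w. \<bar>M\<bar> * \<bar>?P w\<bar> * (\<integral>y. \<bar>?k y\<bar> \<partial>lborel))"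
      by (simp add: abs_mult mult.assoc)
    thus "integrable lborel (\<lambda>w. \<integral>y. norm (case (w, y) of (w, y) \<Rightarrow> M * (?P w * ?k y)) \<partial>lborel)"
      using intP by simp
    show "AE w in lborel. integrable lborel (\<lambda>y. case (w, y) of (w, y) \<Rightarrow> M * (?P w * ?k y))"
      using intk by simp
  qed
  have int: "integrable (lborel \<Otimes>\<^sub>M lborel) (\<lambda>(w, y). ?P w * (f (w + y) * ?k y))"
  proof (rule Bochner_Integration.integrable_bound[OF prod])
    show "(\<lambda>(w, y). ?P w * (f (w + y) * ?k y)) \<in> borel_measurable (lborel \<Otimes>\<^sub>M lborel)"
      by measurable
    have "norm (?P w * (f (w + y) * ?k y)) \<le> norm (M * (?P w * ?k y))" for w y
    proof -
      have "norm (?P w * (f (w + y) * ?k y)) = \<bar>f (w + y)\<bar> * \<bar>?P w * ?k y\<bar>" by (simp add: abs_mult)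
      also have "\<dots> \<le> \<bar>M\<bar> * \<bar>?P w * ?k y\<bar>"
        using M[of "w + y"] by (intro mult_right_mono) auto
      finally show ?thesis by (simp only: abs_mult real_norm_def)
    qed
    thus "AE z in lborel \<Otimes>\<^sub>M lborel. norm (case z of (w, y) \<Rightarrow> ?P w * (f (w + y) * ?k y)) \<le>
        norm (case z of (w, y) \<Rightarrow> M * (?P w * ?k y))" by (auto simp: split_beta)
  qed
  have "(\<integral>w. ?P w * layer f (\<lambda>v. pgrad v \<bullet> l) (x + (w, 0)) \<partial>lborel) =
      (\<integral>w. (\<integral>y. ?P w * (f (w + y) * ?k y) \<partial>lborel) \<partial>lborel)"
  proof (intro Bochner_Integration.integral_cong refl)
    fix w :: "real ^ 'm"
    have "layer f (\<lambda>v. pgrad v \<bullet> l) (x + (w, 0)) =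
        (\<integral>y. f (w + y) * (pgrad (x + (w, 0) - (w + y, 0)) \<bullet> l) \<partial>lborel)"
      unfolding layer_def real_scaleR_def by (rule integral_lborel_translation[symmetric]) measurable
    also have "\<dots> = (\<integral>y. f (w + y) * ?k y \<partial>lborel)"
    proof -
      have "x + (w, 0) - (w + y, 0) = x - (y, 0)" for y :: "real ^ 'm" by (simp add: prod_eq_iff)
      thus ?thesis by (simp only:)
    qed
    finally show "?P w * layer f (\<lambda>v. pgrad v \<bullet> l) (x + (w, 0)) = (\<integral>y. ?P w * (f (w + y) * ?k y) \<partial>lborel)"
      by simp
  qed
  also have "\<dots> = (\<integral>y. (\<integral>w. ?P w * (f (w + y) * ?k y) \<partial>lborel) \<partial>lborel)"
    by (rule lborel_pair.Fubini_integral[symmetric, OF int])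
  also have "\<dots> = (\<integral>y. poisson_integral f (y, d) * ?k y \<partial>lborel)"
  proof (intro Bochner_Integration.integral_cong refl)
    fix y :: "real ^ 'm"
    have "layer f pker (y, d) = (\<integral>w. f (y + w) * pker ((y, d) - (y + w, 0)) \<partial>lborel)"
      unfolding layer_def real_scaleR_def by (rule integral_lborel_translation[symmetric]) measurable
    also have "\<dots> = (\<integral>w. pker ((0, d) - (w, 0)) * f (w + y) \<partial>lborel)"
      by (simp add: add.commute mult.commute)
    finally have "poisson_integral f (y, d) * ?k y = ?c * (\<integral>w. pker ((0, d) - (w, 0)) * f (w + y) \<partial>lborel) * ?k y"
      by (simp add: poisson_integral_eq_layer[OF f])
    also have "\<dots> = (\<integral>w. ?P w * (f (w + y) * ?k y) \<partial>lborel)"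
      by (simp add: mult.assoc[symmetric])
         (simp add: mult.assoc)
    finally show "(\<integral>w. ?P w * (f (w + y) * ?k y) \<partial>lborel) = poisson_integral f (y, d) * ?k y" ..
  qed
  finally show ?thesis by (simp add: layer_def)
qed

lemma pker_scale:
  fixes w :: "(real ^ 'm) \<times> real"
  assumes "d > 0"
  shows "d ^ CARD('m) * pker (d *\<^sub>R w) = pker w"
  using assms by (simp add: pker_def power_mult_distrib)

text \<open>The mollification only sees the oscillation of the slices \<open>y \<mapsto> u (y, d)\<close>, and it converges to
  the derivative as \<open>d\<close> tends to 0; no boundary limits of \<open>u\<close> are needed.\<close>

lemma layer_pgrad_mollified_tendsto:
  fixes f :: "real ^ 'm \<Rightarrow> real"
  assumes f: "bounded_borel f" and x: "x \<in> half_space"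
  shows "(\<lambda>n. layer (\<lambda>y. poisson_integral f (y, 1 / real (Suc n))) (\<lambda>v. pgrad v \<bullet> l) x)
    \<longlonglongrightarrow> layer f (\<lambda>v. pgrad v \<bullet> l) x"
proof -
  let ?c = "poisson_const TYPE('m)"
  let ?G = "\<lambda>w :: real ^ 'm. layer f (\<lambda>v. pgrad v \<bullet> l) (x + (w, 0))"
  let ?P = "\<lambda>w :: real ^ 'm. ?c * pker ((0, 1) - (w, 0))"
  have xw: "x + (w, 0) \<in> half_space" for w :: "real ^ 'm" using x by (simp add: half_space_def)
  have contG: "continuous_on UNIV ?G"
    using continuous_on_compose2[OF layer_continuous[OF tame_inner[OF tame_pgrad] f, of l], of UNIV "\<lambda>w. x + (w, 0)"] xw
    by (simp add: image_subset_iff continuous_intros)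
  have [measurable]: "?G \<in> borel_measurable borel"
    by (rule borel_measurable_continuous_onI[OF contG])
  have one_hs: "(0 :: real ^ 'm, 1) \<in> half_space" by (simp add: half_space_def)
  have intP: "integrable lborel ?P"
    using layer_integrable[OF tame_pker bounded_borel_one one_hs] by simp
  have P1: "(\<integral>w. ?P w \<partial>lborel) = 1"
    using poisson_integral_one[OF one_hs] by (simp add: poisson_integral_eq_layer[OF bounded_borel_one] layer_def)
  obtain M where M: "\<And>y. \<bar>f y\<bar> \<le> M" using f by (auto simp: bounded_borel_def)
  \<comment> \<open>A horizontal shift of \<open>x\<close> does not change the mass of the kernel,
    so the bound is uniform in \<open>w\<close>.\<close>
  have Gb: "\<bar>?G w\<bar> \<le> M * pgrad_mass l x" for w
  proof -
    have "\<bar>?G w\<bar> \<le> M * pgrad_mass l (x + (w, 0))"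
      using layer_pgrad_oscillation[OF f xw, of 0 M l w] M by simp
    also have "pgrad_mass l (x + (w, 0)) = (\<integral>y. \<bar>pgrad (x + (w, 0) - (w + y, 0)) \<bullet> l\<bar> \<partial>lborel)"
      unfolding pgrad_mass_def by (rule integral_lborel_translation[symmetric]) measurable
    also have "\<dots> = pgrad_mass l x"
    proof -
      have "x + (w, 0) - (w + y, 0) = x - (y, 0)" for y :: "real ^ 'm" by (simp add: prod_eq_iff)
      thus ?thesis by (simp only: pgrad_mass_def)
    qed
    finally show ?thesis .
  qed
  \<comment> \<open>Rescaling by \<open>d\<close> fixes the kernel at height 1 and moves
    \<open>d\<close> into the argument of the continuous function \<open>?G\<close>, so one
    integrable majorant serves all \<open>d\<close>.\<close>
  have scaled: "(\<integral>w. ?c * pker ((0, d) - (w, 0)) * ?G w \<partial>lborel) = (\<integral>w. ?P w * ?G (d *\<^sub>R w) \<partial>lborel)"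
    if d: "d > 0" for d
  proof -
    have "(\<integral>w. ?c * pker ((0, d) - (w, 0)) * ?G w \<partial>lborel) =
        \<bar>d\<bar> ^ CARD('m) * (\<integral>w. ?c * pker ((0, d) - (d *\<^sub>R w, 0)) * ?G (d *\<^sub>R w) \<partial>lborel)"
      using d by (subst integral_lborel_scale[of _ d]) simp_all
    also have "\<dots> = (\<integral>w. d ^ CARD('m) * (?c * pker ((0, d) - (d *\<^sub>R w, 0)) * ?G (d *\<^sub>R w)) \<partial>lborel)"
      using d by simp
    also have "\<dots> = (\<integral>w. ?P w * ?G (d *\<^sub>R w) \<partial>lborel)"
    proof (intro Bochner_Integration.integral_cong refl)
      fix w :: "real ^ 'm"
      have "(0, d) - (d *\<^sub>R w, 0) = d *\<^sub>R ((0, 1) - (w, 0))" by simp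
      hence pk: "d ^ CARD('m) * pker ((0, d) - (d *\<^sub>R w, 0)) = pker ((0, 1) - (w, 0))"
        by (simp only: pker_scale[OF d])
      show "d ^ CARD('m) * (?c * pker ((0, d) - (d *\<^sub>R w, 0)) * ?G (d *\<^sub>R w)) = ?P w * ?G (d *\<^sub>R w)"
        unfolding pk[symmetric] by (simp only: mult_ac)
    qed
    finally show ?thesis .
  qed
  have "(\<lambda>n. \<integral>w. ?P w * ?G ((1 / real (Suc n)) *\<^sub>R w) \<partial>lborel) \<longlonglongrightarrow> (\<integral>w. ?P w * ?G 0 \<partial>lborel)"
  proof (rule integral_dominated_convergence)
    show "integrable lborel (\<lambda>w. \<bar>?P w\<bar> * (M * pgrad_mass l x))"
      using intP by (intro integrable_mult_left integrable_abs)
    show "AE w in lborel. (\<lambda>n. ?P w * ?G ((1 / real (Suc n)) *\<^sub>R w)) \<longlonglongrightarrow> ?P w * ?G 0"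
    proof (rule AE_I2)
      fix w :: "real ^ 'm"
      have "(\<lambda>n. (1 / real (Suc n)) *\<^sub>R w) \<longlonglongrightarrow> 0 *\<^sub>R w"
        using LIMSEQ_inverse_real_of_nat by (intro tendsto_intros) (simp add: inverse_eq_divide)
      hence "(\<lambda>n. ?G ((1 / real (Suc n)) *\<^sub>R w)) \<longlonglongrightarrow> ?G 0"
        using contG by (intro continuous_on_tendsto_compose[OF contG]) auto
      thus "(\<lambda>n. ?P w * ?G ((1 / real (Suc n)) *\<^sub>R w)) \<longlonglongrightarrow> ?P w * ?G 0"
        by (rule tendsto_mult_left)
    qed
    show "AE w in lborel. norm (?P w * ?G ((1 / real (Suc n)) *\<^sub>R w)) \<le> \<bar>?P w\<bar> * (M * pgrad_mass l x)" for n
      unfolding real_norm_def abs_mult by (intro AE_I2 mult_left_mono Gb) auto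
  qed measurable
  also have "(\<integral>w. ?P w * ?G 0 \<partial>lborel) = layer f (\<lambda>v. pgrad v \<bullet> l) x"
    using P1 by (simp add: zero_prod_def[symmetric])
  finally show ?thesis
    by (simp only: scaled[symmetric] layer_pgrad_mollified[OF f x] zero_less_divide_1_iff of_nat_0_less_iff zero_less_Suc)
qed

text \<open>The deviation from \<open>b\<close> is assumed for the Poisson integral in the
  half-space and not for \<open>f\<close>: every slice inherits it, and the bound survives the
  limit.\<close>

lemma layer_pgrad_le_osc:
  fixes f :: "real ^ 'm \<Rightarrow> real"
  assumes f: "bounded_borel f" and x: "x \<in> half_space"
    and r: "\<And>z. z \<in> half_space \<Longrightarrow> \<bar>poisson_integral f z - b\<bar> \<le> r"
  shows "layer f (\<lambda>v. pgrad v \<bullet> l) x \<le> r * pgrad_mass l x"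
proof (rule LIMSEQ_le_const2[OF layer_pgrad_mollified_tendsto[OF f x]], intro exI allI impI)
  fix n :: nat
  have "\<bar>layer (\<lambda>y. poisson_integral f (y, 1 / real (Suc n))) (\<lambda>v. pgrad v \<bullet> l) x\<bar> \<le> r * pgrad_mass l x"
    by (rule layer_pgrad_oscillation[OF poisson_slice_bounded_borel[OF f] x, where b = b])
       (auto intro!: r simp: half_space_def)
  thus "layer (\<lambda>y. poisson_integral f (y, 1 / real (Suc n))) (\<lambda>v. pgrad v \<bullet> l) x \<le> r * pgrad_mass l x"
    by linarith
qed

section \<open>The estimate and its sharpness\<close>

lemma deviation_le_half_osc:
  fixes u :: "(real ^ 'm) \<times> real \<Rightarrow> real"
  assumes M: "\<And>z. z \<in> half_space \<Longrightarrow> \<bar>u z\<bar> \<le> M" and z: "z \<in> half_space"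
  shows "\<bar>u z - ((SUP z\<in>half_space. u z) + (INF z\<in>half_space. u z)) / 2\<bar> \<le> osc u / 2"
proof -
  have "bdd_above (u ` half_space)" using M by (intro bdd_aboveI2[of _ _ M]) (simp add: abs_le_iff)
  hence "u z \<le> (SUP z\<in>half_space. u z)" by (rule cSUP_upper[OF z])
  moreover have "bdd_below (u ` half_space)"
    using M by (intro bdd_belowI2[of _ "- M"]) (simp add: abs_le_iff minus_le_iff)
  hence "(INF z\<in>half_space. u z) \<le> u z" by (rule cINF_lower[OF _ z])
  ultimately show ?thesis by (simp add: osc_def abs_le_iff field_simps)
qed

lemma gradient_estimate:
  fixes u :: "(real ^ 'm) \<times> real \<Rightarrow> real"
  assumes u: "u \<in> h_infinity" and x: "x \<in> half_space"
  shows "norm (grad u x) \<le> poisson_const TYPE('m) * half_mass TYPE('m) / snd x * osc u"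
proof -
  let ?c = "poisson_const TYPE('m)"
  obtain f0 where f0: "f0 \<in> L_infinity" "\<And>z. z \<in> half_space \<Longrightarrow> u z = poisson_integral f0 z"
    using u by (auto simp: h_infinity_def)
  obtain f where f: "bounded_borel f" "\<And>z. poisson_integral f0 z = poisson_integral f z"
    by (rule L_infinity_representative[OF f0(1)]) blast
  have uf: "u z = poisson_integral f z" if "z \<in> half_space" for z using f0(2)[OF that] f(2) by simp
  obtain M where M: "\<And>y. \<bar>f y\<bar> \<le> M" using f(1) by (auto simp: bounded_borel_def)
  have uM: "\<bar>u z\<bar> \<le> M" if "z \<in> half_space" for z
    using poisson_integral_bounds[OF f(1) _ _ that, of "- M" M] M uf[OF that] by (auto simp: abs_le_iff minus_le_iff)
  define b where "b = ((SUP z\<in>half_space. u z) + (INF z\<in>half_space. u z)) / 2"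
  have dev: "\<bar>poisson_integral f z - b\<bar> \<le> osc u / 2" if "z \<in> half_space" for z
    using deviation_le_half_osc[of u M z, OF uM that] by (simp add: b_def uf[OF that, symmetric])
  have osc0: "osc u / 2 \<ge> 0" using dev[OF x] by linarith
  have D: "grad u x = ?c *\<^sub>R layer f pgrad x"
    by (rule grad_eqI, rule has_derivative_cong_half_space[OF poisson_integral_has_derivative[OF f(1) x] x])
       (simp add: uf)
  \<comment> \<open>The direction depends on \<open>u\<close> and \<open>x\<close>; this is why the
    bound for \<open>pgrad_mass\<close> has to hold for every unit vector.\<close>
  obtain l where l: "norm l = 1" "grad u x = norm (grad u x) *\<^sub>R l" by (rule unit_direction)
  have "norm (grad u x) = grad u x \<bullet> l"
    by (subst (2) l(2)) (simp add: l(1) power2_norm_eq_inner[symmetric])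
  also have "\<dots> = ?c * layer f (\<lambda>v. pgrad v \<bullet> l) x"
    unfolding D by (simp add: layer_inner[OF tame_pgrad f(1) x])
  also have "\<dots> \<le> ?c * (osc u / 2 * pgrad_mass l x)"
    using poisson_const_pos[where 'm = 'm]
    by (intro mult_left_mono layer_pgrad_le_osc[OF f(1) x, of b] dev) auto
  also have "\<dots> \<le> ?c * (osc u / 2 * (2 * half_mass TYPE('m) / snd x))"
    using poisson_const_pos[where 'm = 'm] osc0
    by (intro mult_left_mono pgrad_mass_le[OF x l(1)]) auto
  finally show ?thesis by (simp add: mult_ac)
qed

text \<open>The oscillation is only bounded by 1, which follows from averaging a function with
  values 0 and 1. For a lower bound on a nonnegative coefficient this suffices.\<close>

lemma gradient_estimate_extremal:
  fixes x :: "(real ^ 'm) \<times> real"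
  assumes x: "x \<in> half_space"
  obtains u where "u \<in> h_infinity" "0 \<le> osc u" "osc u \<le> 1"
    "poisson_const TYPE('m) * half_mass TYPE('m) / snd x \<le> norm (grad u x)"
proof -
  let ?c = "poisson_const TYPE('m)"
  let ?k = "\<lambda>y. pgrad (x - (y, 0)) \<bullet> en"
  define f where "f y = (if ?k y > 0 then 1 else 0 :: real)" for y
  have "f \<in> borel_measurable borel" unfolding f_def[abs_def] by measurable
  moreover have "\<bar>f y\<bar> \<le> 1" for y by (simp add: f_def)
  ultimately have f: "bounded_borel f" unfolding bounded_borel_def by blast
  define u where "u = poisson_integral f"
  have hu: "u \<in> h_infinity"
    using harmonic_poisson_integral[OF f] bounded_borel_in_L_infinity[OF f] by (auto simp: h_infinity_def u_def)
  have u01: "0 \<le> u z" "u z \<le> 1" if "z \<in> half_space" for z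
    using poisson_integral_bounds[OF f _ _ that, of 0 1] by (auto simp: u_def f_def)
  have ne: "(half_space :: ((real ^ 'm) \<times> real) set) \<noteq> {}" using x by blast
  have "(SUP z\<in>half_space. u z) \<le> 1" by (rule cSUP_least[OF ne]) (rule u01)
  moreover have "0 \<le> (INF z\<in>half_space. u z)" by (rule cINF_greatest[OF ne]) (rule u01)
  ultimately have osc1: "osc u \<le> 1" by (simp add: osc_def)
  have "\<bar>u z\<bar> \<le> 1" if "z \<in> half_space" for z using u01[OF that] by linarith
  from order_trans[OF abs_ge_zero deviation_le_half_osc[OF this x]]
  have osc0: "0 \<le> osc u" by simp
  have int: "integrable lborel ?k" by (rule integrable_pgrad_inner[OF x])
  have "layer (\<lambda>_. 1) (\<lambda>w. pgrad w \<bullet> en) x = 0"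
    by (simp add: layer_inner[OF tame_pgrad bounded_borel_one x] layer_one_pgrad[OF x])
  hence k0: "(\<integral>y. ?k y \<partial>lborel) = 0" by (simp add: layer_def)
  \<comment> \<open>Multiplication by \<open>f\<close> selects the positive part of the kernel, and
    by mean zero its integral is half the mass.\<close>
  have "layer f (\<lambda>w. pgrad w \<bullet> en) x = (\<integral>y. (\<bar>?k y\<bar> + ?k y) / 2 \<partial>lborel)"
    unfolding layer_def by (intro Bochner_Integration.integral_cong) (auto simp: f_def)
  also have "\<dots> = pgrad_mass en x / 2"
    using int k0 by (simp add: pgrad_mass_def)
  finally have flux: "layer f (\<lambda>w. pgrad w \<bullet> en) x = half_mass TYPE('m) / snd x"
    by (simp add: pgrad_mass_vertical[OF x])
  have "grad u x = ?c *\<^sub>R layer f pgrad x"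
    unfolding u_def by (rule grad_eqI[OF poisson_integral_has_derivative[OF f x]])
  hence "grad u x \<bullet> en = ?c * (half_mass TYPE('m) / snd x)"
    by (simp add: layer_inner[OF tame_pgrad f x] flux[symmetric])
  moreover have "grad u x \<bullet> en \<le> norm (grad u x)"
    using norm_cauchy_schwarz[of "grad u x" en] by simp
  ultimately have "?c * half_mass TYPE('m) / snd x \<le> norm (grad u x)" by simp
  with hu osc0 osc1 show ?thesis by (rule that)
qed

lemma sqrt_power_eq_powr: "k > 0 \<Longrightarrow> sqrt (real k) ^ k = real k powr (real k / 2)"
  by (simp add: powr_half_sqrt[symmetric] powr_realpow[symmetric] powr_powr)

theorem mainTheorem4:
  fixes n :: nat and x :: "(real ^ 'm) \<times> real" and K :: real
  assumes n: "n \<ge> 2" and dim: "CARD('m) = n - 1"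
    and x: "x \<in> half_space"
    and K: "K = 2 * real (n - 1) powr (real (n - 1) / 2) * omega (n - 1) /
                (real n powr (real n / 2) * omega n * snd x)"
  shows "(\<forall>u\<in>h_infinity. norm (grad u x) \<le> K * osc u) \<and>
         (\<forall>C. (\<forall>u\<in>h_infinity. norm (grad u x) \<le> C * osc u) \<longrightarrow> K \<le> C)"
proof -
  have t: "snd x > 0" using x by (simp add: half_space_def)
  have n': "n = CARD('m) + 1" using n dim by simp
  have K': "K = poisson_const TYPE('m) * half_mass TYPE('m) / snd x"
    unfolding K dim[symmetric] n' poisson_const_def half_mass_def
    using sqrt_power_eq_powr[of "CARD('m)"] sqrt_power_eq_powr[of "CARD('m) + 1"] by (simp add: mult_ac)
  have K0: "K > 0"
    unfolding K' by (intro divide_pos_pos mult_pos_pos poisson_const_pos half_mass_pos t)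
  show ?thesis
  proof (intro conjI ballI allI impI)
    show "norm (grad u x) \<le> K * osc u" if "u \<in> h_infinity" for u
      unfolding K' by (rule gradient_estimate[OF that x])
  next
    fix C assume C: "\<forall>u\<in>h_infinity. norm (grad u x) \<le> C * osc u"
    obtain u where u: "u \<in> h_infinity" "0 \<le> osc u" "osc u \<le> 1" "K \<le> norm (grad u x)"
      using gradient_estimate_extremal[OF x] unfolding K' by blast
    have *: "K \<le> C * osc u" using C u(1,4) by force
    \<comment> \<open>Replacing \<open>osc u\<close> by its upper bound 1 is monotone only for
      nonnegative \<open>C\<close>; a negative \<open>C\<close> would contradict
      \<open>K > 0\<close>.\<close>
    have "C \<ge> 0"
    proof (rule ccontr)
      assume "\<not> C \<ge> 0"
      hence "C * osc u \<le> 0" using u(2) by (intro mult_nonpos_nonneg) auto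
      with * K0 show False by linarith
    qed
    hence "C * osc u \<le> C" using u(3) by (simp add: mult_left_le)
    with * show "K \<le> C" by linarith
  qed
qed

end
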